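(* Let $k$ be a finite field, $r\ge2$, and let $Y$ be an irreducible algebraic set over $F_r$ whose coordinate algebra satisfies $\Gamma(Y)\cong_{F_r}F_r\oplus M$ for a finitely generated torsion-free module $M$ over $R=k[x_1,\dots,x_r]$. Then $\dim(Y)=r(M)$, the rank of $M$.
   Context: $F_r$ is the free metabelian Lie algebra over $k$ with free base $a_1,\dots,a_r$; $F_r^2$ is an $R$-module via $u\cdot x_i=ua_i$. For a torsion-free $R$-module $M$, $F_r\oplus M$ is the Lie algebra on $F_r\oplus M$ with $F_r$ a subalgebra, $MM=0$, and $mu=-um=m\cdot(\sum\alpha_ix_i)$ for $m\in M$, $u\in F_r$, $u\equiv\sum\alpha_ia_i\bmod F_r^2$; $\cong_{F_r}$ means isomorphism identical on $F_r$. The rank $r(M)$ is the maximal cardinality of an $R$-linearly independent subset of $M$. Algebraic sets: $V(S)=\{p\in F_r^n:f(p)=0\ \forall f\in S\}$ for $S\subseteq F_r[X]=F_r\ast F(x_1,\dots,x_n)$; $\mathrm{Rad}(Y)=\{f\in F_r[X]: f(p)=0\ \forall p\in Y\}$; $\Gamma(Y)=F_r[X]/\mathrm{Rad}(Y)$. Zariski topology: algebraic sets form a sub-basis of closed sets; irreducible means not a union of two closed proper subsets. The dimension $\dim(Y)$ of an irreducible algebraic set $Y$ is the maximal $m$ such that there is a chain $Y=Y_0\supsetneq Y_1\supsetneq\dots\supsetneq Y_m$ of irreducible algebraic sets. *)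

theory Defs
  imports "HOL-Analysis.Abstract_Topology" "HOL-Library.Poly_Mapping"
    "HOL-Library.Extended_Nat" "HOL-Algebra.Module"
begin

text \<open>Binary trees over countably many generators: the free nonassociative
  magma; formal k-linear combinations of them form the free nonassociative
  k-algebra.  Generator Leaf i stands for a_(i+1).\<close>

datatype mtree = Leaf nat | Node mtree mtree

type_synonym 'k nalg = "mtree \<Rightarrow>\<^sub>0 'k"

definition nmul :: "'k::field nalg \<Rightarrow> 'k nalg \<Rightarrow> 'k nalg" where
  "nmul f g = (\<Sum>s\<in>Poly_Mapping.keys f. \<Sum>t\<in>Poly_Mapping.keys g. Poly_Mapping.single (Node s t) (Poly_Mapping.lookup f s * Poly_Mapping.lookup g t))"

definition nsmult :: "'k::field \<Rightarrow> 'k nalg \<Rightarrow> 'k nalg" where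
  "nsmult c f = Poly_Mapping.map (\<lambda>x. c * x) f"

inductive_set metab_ideal :: "'k::field nalg set" where
  gen_sq: "nmul x x \<in> metab_ideal"
| gen_jacobi: "nmul (nmul x y) z + nmul (nmul y z) x + nmul (nmul z x) y \<in> metab_ideal"
| gen_metab: "nmul (nmul x y) (nmul z w) \<in> metab_ideal"
| zero: "0 \<in> metab_ideal"
| add: "a \<in> metab_ideal \<Longrightarrow> b \<in> metab_ideal \<Longrightarrow> a + b \<in> metab_ideal"
| smult: "a \<in> metab_ideal \<Longrightarrow> nsmult c a \<in> metab_ideal"
| mul_l: "a \<in> metab_ideal \<Longrightarrow> nmul x a \<in> metab_ideal"
| mul_r: "a \<in> metab_ideal \<Longrightarrow> nmul a x \<in> metab_ideal"

lemma nsmult_minus_one: "nsmult (-1) f = - (f :: 'k::field nalg)"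
  unfolding nsmult_def
  by (rule poly_mapping_eqI) (simp add: Poly_Mapping.map.rep_eq when_def)

lemma metab_ideal_equivp: "equivp (\<lambda>f g. (f::'k::field nalg) - g \<in> metab_ideal)"
proof (rule equivpI)
  show "reflp (\<lambda>f g. (f::'k nalg) - g \<in> metab_ideal)"
    by (simp add: reflp_def metab_ideal.zero)
  show "symp (\<lambda>f g. (f::'k nalg) - g \<in> metab_ideal)"
    unfolding symp_def
  proof (intro allI impI)
    fix f g :: "'k nalg" assume "f - g \<in> metab_ideal"
    then have "nsmult (-1) (f - g) \<in> metab_ideal" by (rule metab_ideal.smult)
    then show "g - f \<in> metab_ideal" by (simp add: nsmult_minus_one)
  qed
  show "transp (\<lambda>f g. (f::'k nalg) - g \<in> metab_ideal)"
    unfolding transp_def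
  proof (intro allI impI)
    fix f g h :: "'k nalg" assume "f - g \<in> metab_ideal" "g - h \<in> metab_ideal"
    then have "(f - g) + (g - h) \<in> metab_ideal" by (rule metab_ideal.add)
    then show "f - h \<in> metab_ideal" by simp
  qed
qed

quotient_type (overloaded) 'k fml = "'k::field nalg" / "\<lambda>f g. f - g \<in> metab_ideal"
  by (rule metab_ideal_equivp)

definition fadd :: "'k::field fml \<Rightarrow> 'k fml \<Rightarrow> 'k fml" where
  "fadd a b = abs_fml (rep_fml a + rep_fml b)"

definition fsmult :: "'k::field \<Rightarrow> 'k fml \<Rightarrow> 'k fml" where
  "fsmult c a = abs_fml (nsmult c (rep_fml a))"

definition fbr :: "'k::field fml \<Rightarrow> 'k fml \<Rightarrow> 'k fml" where
  "fbr a b = abs_fml (nmul (rep_fml a) (rep_fml b))"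

definition fzero :: "'k::field fml" where
  "fzero = abs_fml 0"

fun leaves :: "mtree \<Rightarrow> nat set" where
  "leaves (Leaf i) = {i}"
| "leaves (Node s t) = leaves s \<union> leaves t"

text \<open>F_m: the free metabelian Lie algebra with free base a_1,...,a_m
  (generators Leaf 0, ..., Leaf (m-1)), as a subalgebra of the above.\<close>

definition Fr :: "nat \<Rightarrow> 'k::field fml set" where
  "Fr m = {abs_fml f | f. \<forall>t\<in>Poly_Mapping.keys f. \<forall>i\<in>leaves t. i < m}"

text \<open>F_r[X] = F_r * F(x_1,...,x_n) is the free metabelian Lie algebra
  F_(r+n) with a_i = Leaf (i-1) (i \<le> r) and x_j = Leaf (r+j-1).
  Evaluation at a point p of F_r^n substitutes x_j by p_j and fixes the a_i.\<close>

fun tsubst :: "(nat \<Rightarrow> 'k::field nalg) \<Rightarrow> mtree \<Rightarrow> 'k nalg" where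
  "tsubst \<sigma> (Leaf i) = \<sigma> i"
| "tsubst \<sigma> (Node s t) = nmul (tsubst \<sigma> s) (tsubst \<sigma> t)"

definition nsubst :: "(nat \<Rightarrow> 'k::field nalg) \<Rightarrow> 'k nalg \<Rightarrow> 'k nalg" where
  "nsubst \<sigma> f = (\<Sum>t\<in>Poly_Mapping.keys f. nsmult (Poly_Mapping.lookup f t) (tsubst \<sigma> t))"

definition eval_at :: "nat \<Rightarrow> nat \<Rightarrow> 'k::field fml \<Rightarrow> 'k fml list \<Rightarrow> 'k fml" where
  "eval_at r n f p = abs_fml (nsubst
     (\<lambda>i. if i < r then Poly_Mapping.single (Leaf i) 1
          else if i < r + n then rep_fml (p ! (i - r)) else 0) (rep_fml f))"

definition affine :: "nat \<Rightarrow> nat \<Rightarrow> 'k::field fml list set" where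
  "affine r n = {p. length p = n \<and> set p \<subseteq> Fr r}"

definition Vset :: "nat \<Rightarrow> nat \<Rightarrow> 'k::field fml set \<Rightarrow> 'k fml list set" where
  "Vset r n S = {p \<in> affine r n. \<forall>f\<in>S. eval_at r n f p = fzero}"

definition algebraic_set :: "nat \<Rightarrow> nat \<Rightarrow> 'k::field fml list set \<Rightarrow> bool" where
  "algebraic_set r n Y \<longleftrightarrow> (\<exists>S. S \<subseteq> Fr (r + n) \<and> Y = Vset r n S)"

definition Rad :: "nat \<Rightarrow> nat \<Rightarrow> 'k::field fml list set \<Rightarrow> 'k fml set" where
  "Rad r n Y = {f \<in> Fr (r + n). \<forall>p\<in>Y. eval_at r n f p = fzero}"

definition zariski :: "nat \<Rightarrow> nat \<Rightarrow> 'k::field fml list topology" where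
  "zariski r n = topology_generated_by
     (insert (affine r n) {affine r n - Vset r n S | S. S \<subseteq> Fr (r + n)})"

definition z_irreducible :: "nat \<Rightarrow> nat \<Rightarrow> 'k::field fml list set \<Rightarrow> bool" where
  "z_irreducible r n Y \<longleftrightarrow> Y \<noteq> {} \<and> Y \<subseteq> affine r n \<and>
     \<not> (\<exists>Y1 Y2. closedin (subtopology (zariski r n) Y) Y1 \<and>
               closedin (subtopology (zariski r n) Y) Y2 \<and>
               Y1 \<subset> Y \<and> Y2 \<subset> Y \<and> Y = Y1 \<union> Y2)"

definition zdim :: "nat \<Rightarrow> nat \<Rightarrow> 'k::field fml list set \<Rightarrow> enat" where
  "zdim r n Y = (SUP m \<in> {m. \<exists>c. c 0 = Y \<and>
        (\<forall>i\<le>m. algebraic_set r n (c i) \<and> z_irreducible r n (c i)) \<and>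
        (\<forall>i<m. c (Suc i) \<subset> c i)}. enat m)"

type_synonym 'k kpoly = "(nat \<Rightarrow>\<^sub>0 nat) \<Rightarrow>\<^sub>0 'k"

definition Rring :: "nat \<Rightarrow> ('k::field kpoly) ring" where
  "Rring r = \<lparr>carrier = {p. \<forall>mon\<in>Poly_Mapping.keys p. \<forall>v\<in>Poly_Mapping.keys mon. v < r},
              monoid.mult = (*), one = 1, zero = 0, add = (+)\<rparr>"

definition kconst :: "'k::field \<Rightarrow> 'k kpoly" where
  "kconst c = Poly_Mapping.single 0 c"

text \<open>Linear part: u \<equiv> sum alpha_i a_i mod F_r^2 gives sum alpha_i x_i.\<close>

definition linpart :: "nat \<Rightarrow> 'k::field fml \<Rightarrow> 'k kpoly" where
  "linpart r u = (\<Sum>i<r. Poly_Mapping.single (Poly_Mapping.single i 1)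
                                             (Poly_Mapping.lookup (rep_fml u) (Leaf i)))"

definition torsion_free :: "('a, 'b) ring_scheme \<Rightarrow> ('a, 'm) module \<Rightarrow> bool" where
  "torsion_free R M \<longleftrightarrow> (\<forall>a\<in>carrier R. \<forall>x\<in>carrier M.
      a \<odot>\<^bsub>M\<^esub> x = \<zero>\<^bsub>M\<^esub> \<longrightarrow> a = \<zero>\<^bsub>R\<^esub> \<or> x = \<zero>\<^bsub>M\<^esub>)"

definition fin_gen :: "('a, 'b) ring_scheme \<Rightarrow> ('a, 'm) module \<Rightarrow> bool" where
  "fin_gen R M \<longleftrightarrow> (\<exists>G. finite G \<and> G \<subseteq> carrier M \<and>
      carrier M = {finsum M (\<lambda>g. c g \<odot>\<^bsub>M\<^esub> g) G | c. c \<in> G \<rightarrow> carrier R})"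

definition lin_indep :: "('a, 'b) ring_scheme \<Rightarrow> ('a, 'm) module \<Rightarrow> 'm set \<Rightarrow> bool" where
  "lin_indep R M S \<longleftrightarrow> S \<subseteq> carrier M \<and>
     (\<forall>T c. finite T \<longrightarrow> T \<subseteq> S \<longrightarrow> c \<in> T \<rightarrow> carrier R \<longrightarrow>
        finsum M (\<lambda>v. c v \<odot>\<^bsub>M\<^esub> v) T = \<zero>\<^bsub>M\<^esub> \<longrightarrow> (\<forall>v\<in>T. c v = \<zero>\<^bsub>R\<^esub>))"

definition mrank :: "('a, 'b) ring_scheme \<Rightarrow> ('a, 'm) module \<Rightarrow> enat" where
  "mrank R M = (SUP S \<in> {S. lin_indep R M S}. enat (card S))"

definition sd_add :: "('k::field kpoly, 'm) module \<Rightarrow> 'k fml \<times> 'm \<Rightarrow> 'k fml \<times> 'm \<Rightarrow> 'k fml \<times> 'm" where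
  "sd_add M x y = (fadd (fst x) (fst y), snd x \<oplus>\<^bsub>M\<^esub> snd y)"

definition sd_smult :: "('k::field kpoly, 'm) module \<Rightarrow> 'k \<Rightarrow> 'k fml \<times> 'm \<Rightarrow> 'k fml \<times> 'm" where
  "sd_smult M c x = (fsmult c (fst x), kconst c \<odot>\<^bsub>M\<^esub> snd x)"

text \<open>(u + m)(v + n) = uv + m.(lin v) - n.(lin u), since mv = -vm = m.(lin v).\<close>

definition sd_br :: "nat \<Rightarrow> ('k::field kpoly, 'm) module \<Rightarrow> 'k fml \<times> 'm \<Rightarrow> 'k fml \<times> 'm \<Rightarrow> 'k fml \<times> 'm" where
  "sd_br r M x y = (fbr (fst x) (fst y),
      (linpart r (fst y) \<odot>\<^bsub>M\<^esub> snd x) \<oplus>\<^bsub>M\<^esub> ((- linpart r (fst x)) \<odot>\<^bsub>M\<^esub> snd y))"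

definition coset :: "nat \<Rightarrow> nat \<Rightarrow> 'k::field fml list set \<Rightarrow> 'k fml \<Rightarrow> 'k fml set" where
  "coset r n Y f = {g \<in> Fr (r + n). fadd g (fsmult (-1) f) \<in> Rad r n Y}"

definition Gamma :: "nat \<Rightarrow> nat \<Rightarrow> 'k::field fml list set \<Rightarrow> 'k fml set set" where
  "Gamma r n Y = coset r n Y ` Fr (r + n)"

definition coord_iso_Fr :: "nat \<Rightarrow> nat \<Rightarrow> 'k::field fml list set \<Rightarrow> ('k kpoly, 'm) module \<Rightarrow> bool" where
  "coord_iso_Fr r n Y M \<longleftrightarrow> (\<exists>\<psi>. bij_betw \<psi> (Gamma r n Y) (Fr r \<times> carrier M) \<and>
     (\<forall>f\<in>Fr (r + n). \<forall>g\<in>Fr (r + n).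
        \<psi> (coset r n Y (fadd f g)) = sd_add M (\<psi> (coset r n Y f)) (\<psi> (coset r n Y g)) \<and>
        \<psi> (coset r n Y (fbr f g)) = sd_br r M (\<psi> (coset r n Y f)) (\<psi> (coset r n Y g))) \<and>
     (\<forall>c. \<forall>f\<in>Fr (r + n). \<psi> (coset r n Y (fsmult c f)) = sd_smult M c (\<psi> (coset r n Y f))) \<and>
     (\<forall>u\<in>Fr r. \<psi> (coset r n Y u) = (u, \<zero>\<^bsub>M\<^esub>)))"

end

(* Evaluation at a point of Y is a homomorphism from F_r + M to F_r that is the identity on F_r.
   It maps M into the derived algebra F_r^2, because M commutes with F_r^2; hence Y corresponds to
   Hom_R(M, F_r^2), and algebraic subsets of Y are the solution sets of systems phi(m) = -u with
   m in M and u in F_r. The Magnus embedding realises F_r^2 as a submodule of R^r, so F_r^2 is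
   torsion-free, and every nonempty algebraic subset of Y is irreducible: along a line p + c (q - p)
   with c in R an equation that fails at p or q fails for all but at most one c. So the dimension is the
   maximal length of a chain of nonempty algebraic subsets. The equations cutting out successive
   members of such a chain have linearly independent module parts, and conversely independent elements
   of M cut out a strict chain since they are separated by linear functionals M -> R. *)
theory Submission
  imports Defs "HOL-Library.Multiset"
begin

section \<open>The free metabelian Lie algebra\<close>

text \<open>Injectivity of the Magnus embedding is hidden by the definition: \<open>fml\<close> is a
  quotient by an inductively generated ideal, with no normal form at hand. It is obtained from an
  explicit left inverse \<open>unmagnus\<close>, defined monomial by monomial on R^r. Afterwards
  identities in \<open>Fr r\<close> are checked on the polynomial coordinates \<open>linpart\<close>
  and \<open>fox\<close>, and the R-module structure of the derived algebra need not be set up: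
  bracketing with \<open>gen i\<close> multiplies the coordinates by the i-th variable. The
  parameter of a line has to range over R and not over k. A finite k offers too few parameters to
  avoid finitely many zeros, while the powers of one variable are infinitely many elements of R.
  Over the fraction field of R separating functionals are linear algebra; finite generation of M
  supplies one common denominator that brings them back to R. Such a functional becomes a
  homomorphism into the derived algebra after multiplication by one fixed commutator of two
  generators, which is nonzero since r is at least 2.\<close>

lemma poly_mapping_single_induct [case_names zero single add]:
  fixes f :: "'a \<Rightarrow>\<^sub>0 'b::comm_monoid_add"
  assumes "P 0" "\<And>t c. P (Poly_Mapping.single t c)" "\<And>f g. P f \<Longrightarrow> P g \<Longrightarrow> P (f + g)"
  shows "P f"
proof -
  have f: "f = (\<Sum>t\<in>Poly_Mapping.keys f. Poly_Mapping.single t (Poly_Mapping.lookup f t))"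
    by (rule poly_mapping_eqI)
       (simp add: lookup_sum lookup_single when_def in_keys_iff)
  have "P (\<Sum>t\<in>A. Poly_Mapping.single t (Poly_Mapping.lookup f t))" if "finite A" for A
    using that by (induct A) (use assms in auto)
  then show ?thesis using f by (metis finite_keys)
qed

section \<open>Bilinear arithmetic in the free nonassociative algebra\<close>

lemma lookup_nsmult: "Poly_Mapping.lookup (nsmult c f) t = c * Poly_Mapping.lookup f t"
  unfolding nsmult_def by (simp add: Poly_Mapping.map.rep_eq when_def)

lemma nsmult_simps:
  "nsmult c (f + g) = nsmult c f + nsmult c g"
  "nsmult (a + b) f = nsmult a f + nsmult b f"
  "nsmult a (nsmult b f) = nsmult (a * b) f"
  "nsmult c (Poly_Mapping.single t d) = Poly_Mapping.single t (c * d)"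
  "nsmult 1 f = f" "nsmult 0 f = 0" "nsmult c 0 = 0"
  by (rule poly_mapping_eqI; simp add: lookup_nsmult lookup_add algebra_simps lookup_single when_def)+

lemma nmul_add_left: "nmul (f + f') g = nmul f g + nmul f' g"
  unfolding nmul_def
  by (subst setsum_keys_plus_distrib) (auto simp: algebra_simps single_add sum.distrib)

lemma nmul_swap: "nmul f g = (\<Sum>t\<in>Poly_Mapping.keys g. \<Sum>s\<in>Poly_Mapping.keys f.
    Poly_Mapping.single (Node s t) (Poly_Mapping.lookup f s * Poly_Mapping.lookup g t))"
  unfolding nmul_def by (rule sum.swap)

lemma nmul_add_right: "nmul f (g + g') = nmul f g + nmul f g'"
  unfolding nmul_swap
  by (subst setsum_keys_plus_distrib) (auto simp: algebra_simps single_add sum.distrib)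

lemma nmul_single:
  "nmul (Poly_Mapping.single s a) (Poly_Mapping.single t b) = Poly_Mapping.single (Node s t) (a * b)"
  unfolding nmul_def by (cases "a = 0"; cases "b = 0") auto

lemma nmul_zero [simp]: "nmul 0 g = 0" "nmul g 0 = 0"
  unfolding nmul_def by auto

lemma nmul_nsmult_left: "nmul (nsmult c f) g = nsmult c (nmul f g)"
proof (induct f rule: poly_mapping_single_induct)
  case (single s a)
  show ?case
    by (induct g rule: poly_mapping_single_induct)
       (auto simp: nsmult_simps nmul_single nmul_add_right mult.assoc)
qed (auto simp: nsmult_simps nmul_add_left)

lemma nmul_nsmult_right: "nmul f (nsmult c g) = nsmult c (nmul f g)"
proof (induct f rule: poly_mapping_single_induct)
  case (single s a)
  show ?case
    by (induct g rule: poly_mapping_single_induct)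
       (auto simp: nsmult_simps nmul_single nmul_add_right algebra_simps)
qed (auto simp: nsmult_simps nmul_add_left)

lemma nmul_minus: "nmul (- f) g = - nmul f g" "nmul f (- g) = - nmul f g"
  by (metis nmul_nsmult_left nsmult_minus_one, metis nmul_nsmult_right nsmult_minus_one)

section \<open>Operations and Lie identities on the quotient\<close>

lemma abs_fml_eq_iff: "abs_fml f = abs_fml g \<longleftrightarrow> f - g \<in> metab_ideal"
  by (simp add: fml.abs_eq_iff)

lemma abs_rep_fml [simp]: "abs_fml (rep_fml u) = u"
  by (rule Quotient3_abs_rep[OF Quotient3_fml])

lemma rep_abs_fml: "rep_fml (abs_fml f) - f \<in> metab_ideal"
  by (simp add: abs_fml_eq_iff[symmetric])

lemma fadd_abs: "fadd (abs_fml f) (abs_fml g) = abs_fml (f + g)"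
  unfolding fadd_def abs_fml_eq_iff
  using metab_ideal.add[OF rep_abs_fml rep_abs_fml, of f g] by (simp add: algebra_simps)

lemma fsmult_abs: "fsmult c (abs_fml f) = abs_fml (nsmult c f)"
proof -
  have "nsmult c (rep_fml (abs_fml f)) - nsmult c f = nsmult c (rep_fml (abs_fml f) - f)"
    by (rule poly_mapping_eqI) (simp add: lookup_nsmult lookup_minus algebra_simps)
  then show ?thesis
    unfolding fsmult_def abs_fml_eq_iff using metab_ideal.smult[OF rep_abs_fml, of c f] by simp
qed

lemma fbr_abs: "fbr (abs_fml f) (abs_fml g) = abs_fml (nmul f g)"
proof -
  let ?f = "rep_fml (abs_fml f)" and ?g = "rep_fml (abs_fml g)"
  have "nmul ?f ?g - nmul f g = nmul (?f - f) ?g + nmul f (?g - g)"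
    unfolding diff_conv_add_uminus nmul_add_left nmul_add_right nmul_minus by simp
  then show ?thesis
    unfolding fbr_def abs_fml_eq_iff
    using metab_ideal.add[OF metab_ideal.mul_r[OF rep_abs_fml] metab_ideal.mul_l[OF rep_abs_fml],
        of f ?g f g] by simp
qed

instantiation fml :: (field) ab_group_add
begin
definition "(0 :: 'a fml) = fzero"
definition "(a :: 'a fml) + b = fadd a b"
definition "- (a :: 'a fml) = fsmult (-1) a"
definition "(a :: 'a fml) - b = fadd a (fsmult (-1) b)"

lemma fml_abs_simps:
  "0 = abs_fml (0 :: 'a nalg)" "abs_fml f + abs_fml g = abs_fml (f + g)"
  "- abs_fml f = abs_fml (- f)" "abs_fml f - abs_fml g = abs_fml (f - g)"
  for f g :: "'a nalg"
  by (simp_all add: zero_fml_def fzero_def plus_fml_def uminus_fml_def minus_fml_def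
      fadd_abs fsmult_abs nsmult_minus_one)

instance
proof
  fix a b c :: "'a fml"
  show "a + b + c = a + (b + c)"
    by (metis abs_rep_fml fml_abs_simps(2) add.assoc)
  show "a + b = b + a" by (metis abs_rep_fml fml_abs_simps(2) add.commute)
  show "0 + a = a" by (metis abs_rep_fml fml_abs_simps(1,2) add_0)
  show "- a + a = 0" by (metis abs_rep_fml fml_abs_simps(1,2,3) ab_left_minus)
  show "a - b = a + - b" by (simp add: minus_fml_def plus_fml_def uminus_fml_def)
qed
end

lemma fml_cases: obtains f where "u = abs_fml f"
  by (metis abs_rep_fml)

lemma fbr_add_left: "fbr (u + v) w = fbr u w + fbr v w"
  by (metis abs_rep_fml fml_abs_simps(2) fbr_abs nmul_add_left)

lemma fbr_add_right: "fbr w (u + v) = fbr w u + fbr w v"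
  by (metis abs_rep_fml fml_abs_simps(2) fbr_abs nmul_add_right)

lemma fbr_smult_left: "fbr (fsmult c u) w = fsmult c (fbr u w)"
  by (metis abs_rep_fml fsmult_abs fbr_abs nmul_nsmult_left)

lemma fbr_smult_right: "fbr w (fsmult c u) = fsmult c (fbr w u)"
  by (metis abs_rep_fml fsmult_abs fbr_abs nmul_nsmult_right)

lemma fbr_zero [simp]: "fbr 0 w = 0" "fbr w 0 = 0"
  by (metis add_cancel_right_left fbr_add_left, metis add_cancel_right_left fbr_add_right)

lemma fbr_minus: "fbr (- u) w = - fbr u w" "fbr w (- u) = - fbr w u"
  by (simp_all add: uminus_fml_def fbr_smult_left fbr_smult_right)

lemma fbr_sum_left: "fbr (sum f A) w = (\<Sum>i\<in>A. fbr (f i) w)"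
  by (induct A rule: infinite_finite_induct) (auto simp: fbr_add_left)

lemma fbr_self [simp]: "fbr u u = 0"
  by (cases u rule: fml_cases)
     (auto simp: fbr_abs fml_abs_simps abs_fml_eq_iff intro: metab_ideal.gen_sq)

text \<open>Polarisation of \<open>fbr_self\<close> at \<open>u + v\<close>; this direction is valid
  in characteristic 2 as well.\<close>

lemma fbr_anti: "fbr u v = - fbr v u"
proof -
  have "fbr (u + v) (u + v) = 0" by (rule fbr_self)
  then show ?thesis
    unfolding fbr_add_left fbr_add_right by (simp add: eq_neg_iff_add_eq_0 add.commute)
qed

lemma fbr_jacobi: "fbr (fbr u v) w + fbr (fbr v w) u + fbr (fbr w u) v = 0"
  by (cases u rule: fml_cases, cases v rule: fml_cases, cases w rule: fml_cases)
     (auto simp: fbr_abs fml_abs_simps abs_fml_eq_iff intro: metab_ideal.gen_jacobi)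

lemma fbr_metab [simp]: "fbr (fbr u v) (fbr w z) = 0"
  by (cases u rule: fml_cases, cases v rule: fml_cases, cases w rule: fml_cases, cases z rule: fml_cases)
     (auto simp: fbr_abs fml_abs_simps abs_fml_eq_iff intro: metab_ideal.gen_metab)

lemma fsmult_simps:
  "fsmult c (u + v) = fsmult c u + fsmult c v"
  "fsmult (a + b) u = fsmult a u + fsmult b u"
  "fsmult a (fsmult b u) = fsmult (a * b) u"
  "fsmult 1 u = u" "fsmult 0 u = 0" "fsmult c 0 = 0"
  by (cases u rule: fml_cases, cases v rule: fml_cases,
      auto simp: fsmult_abs fml_abs_simps nsmult_simps)+

lemma fsmult_sum: "fsmult c (sum f A) = (\<Sum>i\<in>A. fsmult c (f i))"
  by (induct A rule: infinite_finite_induct) (auto simp: fsmult_simps)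

lemma fadd_eq [simp]: "fadd u v = u + v"
  and fzero_eq [simp]: "fzero = 0"
  by (simp_all add: plus_fml_def zero_fml_def)

section \<open>The subalgebras \<open>Fr m\<close> and their generators\<close>

definition gen :: "nat \<Rightarrow> 'k::field fml" where
  "gen i = abs_fml (Poly_Mapping.single (Leaf i) 1)"

lemma Fr_zero [simp, intro]: "0 \<in> Fr m"
  unfolding Fr_def fml_abs_simps(1) by force

lemma Fr_gen [intro]: "i < m \<Longrightarrow> gen i \<in> Fr m"
  unfolding Fr_def gen_def by force

lemma Fr_add [intro]:
  assumes "u \<in> Fr m" "v \<in> Fr m" shows "u + v \<in> Fr m"
proof -
  obtain f g where "u = abs_fml f" "\<forall>t\<in>Poly_Mapping.keys f. \<forall>i\<in>leaves t. i < m"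
    "v = abs_fml g" "\<forall>t\<in>Poly_Mapping.keys g. \<forall>i\<in>leaves t. i < m"
    using assms unfolding Fr_def by blast
  then show ?thesis unfolding Fr_def using keys_add[of f g]
    by (auto simp: fml_abs_simps intro!: exI[of _ "f+g"])
qed

lemma Fr_smult [intro]:
  assumes "u \<in> Fr m" shows "fsmult c u \<in> Fr m"
proof -
  obtain f where "u = abs_fml f" "\<forall>t\<in>Poly_Mapping.keys f. \<forall>i\<in>leaves t. i < m"
    using assms unfolding Fr_def by blast
  moreover have "Poly_Mapping.keys (nsmult c f) \<subseteq> Poly_Mapping.keys f"
    by (auto simp: in_keys_iff lookup_nsmult)
  ultimately show ?thesis unfolding Fr_def
    by (auto simp: fsmult_abs intro!: exI[of _ "nsmult c f"])
qed

lemma keys_nmul: "Poly_Mapping.keys (nmul f g) \<subseteq>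
  {Node s t | s t. s \<in> Poly_Mapping.keys f \<and> t \<in> Poly_Mapping.keys g}"
  unfolding nmul_def
  using keys_sum keys_single
  by (smt (verit) Collect_mono UN_E insert_iff mem_Collect_eq singletonD subset_eq empty_iff)

lemma Fr_br [intro]:
  assumes "u \<in> Fr m" "v \<in> Fr m" shows "fbr u v \<in> Fr m"
proof -
  obtain f g where "u = abs_fml f" "\<forall>t\<in>Poly_Mapping.keys f. \<forall>i\<in>leaves t. i < m"
    "v = abs_fml g" "\<forall>t\<in>Poly_Mapping.keys g. \<forall>i\<in>leaves t. i < m"
    using assms unfolding Fr_def by blast
  moreover from this have "\<forall>t\<in>Poly_Mapping.keys (nmul f g). \<forall>i\<in>leaves t. i < m"
    using keys_nmul[of f g] by fastforce
  ultimately show ?thesis unfolding Fr_def by (auto simp: fbr_abs)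
qed

lemma Fr_uminus [intro]: "u \<in> Fr m \<Longrightarrow> - u \<in> Fr m"
  by (auto simp: uminus_fml_def)

lemma Fr_diff [intro]: "u \<in> Fr m \<Longrightarrow> v \<in> Fr m \<Longrightarrow> u - v \<in> Fr m"
  by (metis diff_conv_add_uminus Fr_add Fr_uminus)

lemma Fr_mono: "m \<le> m' \<Longrightarrow> Fr m \<subseteq> Fr m'"
  unfolding Fr_def by force

text \<open>Replaces the definition by representatives with small leaves by generation as an
  algebra: a tree monomial is an iterated bracket of generators, and a representative is a finite
  linear combination of such monomials.\<close>

lemma Fr_induct [consumes 1, case_names zero gen add smult br]:
  fixes u :: "'k::field fml"
  assumes "u \<in> Fr m" and "P 0" "\<And>i. i < m \<Longrightarrow> P (gen i)"
    "\<And>u v. u \<in> Fr m \<Longrightarrow> v \<in> Fr m \<Longrightarrow> P u \<Longrightarrow> P v \<Longrightarrow> P (u + v)"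
    "\<And>u c. u \<in> Fr m \<Longrightarrow> P u \<Longrightarrow> P (fsmult c u)"
    "\<And>u v. u \<in> Fr m \<Longrightarrow> v \<in> Fr m \<Longrightarrow> P u \<Longrightarrow> P v \<Longrightarrow> P (fbr u v)"
  shows "P u"
proof -
  have tree: "abs_fml (Poly_Mapping.single t (1 :: 'k)) \<in> Fr m \<and> P (abs_fml (Poly_Mapping.single t 1))"
    if "\<forall>i\<in>leaves t. i < m" for t
    using that
  proof (induct t)
    case (Leaf i) then show ?case using assms(3) by (auto simp: gen_def[symmetric])
  next
    case (Node s t)
    have "abs_fml (Poly_Mapping.single (Node s t) (1 :: 'k))
        = fbr (abs_fml (Poly_Mapping.single s 1)) (abs_fml (Poly_Mapping.single t 1))"
      by (simp add: fbr_abs nmul_single)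
    then show ?case using Node assms(6) by auto
  qed
  obtain f where f: "u = abs_fml f" "\<forall>t\<in>Poly_Mapping.keys f. \<forall>i\<in>leaves t. i < m"
    using assms(1) unfolding Fr_def by blast
  have sum: "abs_fml (\<Sum>t\<in>A. Poly_Mapping.single t (Poly_Mapping.lookup f t)) \<in> Fr m \<and>
     P (abs_fml (\<Sum>t\<in>A. Poly_Mapping.single t (Poly_Mapping.lookup f t)))"
    if "finite A" "A \<subseteq> Poly_Mapping.keys f" for A
    using that
  proof (induct A)
    case empty then show ?case using assms(2) by (simp add: fml_abs_simps[symmetric])
  next
    case (insert t A)
    have "abs_fml (Poly_Mapping.single t (Poly_Mapping.lookup f t))
        = fsmult (Poly_Mapping.lookup f t) (abs_fml (Poly_Mapping.single t 1))"
      by (simp add: fsmult_abs nsmult_simps)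
    moreover have "fsmult (Poly_Mapping.lookup f t) (abs_fml (Poly_Mapping.single t 1)) \<in> Fr m \<and>
        P (fsmult (Poly_Mapping.lookup f t) (abs_fml (Poly_Mapping.single t 1)))"
      using insert tree[of t] f(2) assms(5) by auto
    ultimately show ?case using insert assms(4)
      by (auto simp: fml_abs_simps[symmetric])
  qed
  have "f = (\<Sum>t\<in>Poly_Mapping.keys f. Poly_Mapping.single t (Poly_Mapping.lookup f t))"
    by (rule poly_mapping_eqI)
       (simp add: lookup_sum lookup_single when_def in_keys_iff)
  then show ?thesis using sum[of "Poly_Mapping.keys f"] f(1) by (metis finite_keys subset_refl)
qed

section \<open>Substitution and evaluation as homomorphisms\<close>

lemma nsubst_add: "nsubst \<sigma> (f + g) = nsubst \<sigma> f + nsubst \<sigma> g"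
  unfolding nsubst_def by (subst setsum_keys_plus_distrib) (auto simp: nsmult_simps)

lemma nsubst_single: "nsubst \<sigma> (Poly_Mapping.single t c) = nsmult c (tsubst \<sigma> t)"
  unfolding nsubst_def by (cases "c = 0") (auto simp: nsmult_simps)

lemma nsubst_zero: "nsubst \<sigma> 0 = 0"
  unfolding nsubst_def by simp

lemma nsubst_nsmult: "nsubst \<sigma> (nsmult c f) = nsmult c (nsubst \<sigma> f)"
  by (induct f rule: poly_mapping_single_induct)
     (auto simp: nsubst_add nsubst_single nsubst_zero nsmult_simps)

lemma nsubst_nmul: "nsubst \<sigma> (nmul f g) = nmul (nsubst \<sigma> f) (nsubst \<sigma> g)"
proof (induct f rule: poly_mapping_single_induct)
  case (single s a)
  show ?case
    by (induct g rule: poly_mapping_single_induct)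
       (auto simp: nsmult_simps nsubst_zero nmul_single nmul_add_right nsubst_add nsubst_single
         nmul_nsmult_left nmul_nsmult_right mult.commute)
qed (auto simp: nsubst_add nsubst_zero nmul_add_left)

text \<open>The ideal is generated by the identities at all elements, not only at generators, so a
  substitution maps each generating element to another one. Hence evaluation does not depend on the
  representative.\<close>

lemma nsubst_ideal: "f \<in> metab_ideal \<Longrightarrow> nsubst \<sigma> f \<in> metab_ideal"
  by (induct rule: metab_ideal.induct)
     (auto simp: nsubst_nmul nsubst_add nsubst_zero nsubst_nsmult intro: metab_ideal.intros)

lemma nsubst_abs_cong:
  assumes "abs_fml f = abs_fml g" shows "abs_fml (nsubst \<sigma> f) = abs_fml (nsubst \<sigma> g)"
proof -
  have "nsubst \<sigma> f = nsubst \<sigma> (f - g) + nsubst \<sigma> g"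
    by (simp add: nsubst_add[symmetric])
  then show ?thesis using nsubst_ideal[of "f - g" \<sigma>] assms by (simp add: abs_fml_eq_iff)
qed

lemma eval_abs: "eval_at r n (abs_fml f) p = abs_fml (nsubst
     (\<lambda>i. if i < r then Poly_Mapping.single (Leaf i) 1
          else if i < r + n then rep_fml (p ! (i - r)) else 0) f)"
  unfolding eval_at_def by (rule nsubst_abs_cong) simp

lemma eval_add [simp]: "eval_at r n (u + v) p = eval_at r n u p + eval_at r n v p"
  by (cases u rule: fml_cases, cases v rule: fml_cases)
     (simp add: fml_abs_simps eval_abs nsubst_add)

lemma eval_zero [simp]: "eval_at r n 0 p = 0"
  by (metis eval_add add_cancel_right_left)

lemma eval_smult [simp]: "eval_at r n (fsmult c u) p = fsmult c (eval_at r n u p)"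
  by (cases u rule: fml_cases) (simp add: fsmult_abs eval_abs nsubst_nsmult)

lemma eval_minus [simp]: "eval_at r n (- u) p = - eval_at r n u p"
  by (simp add: uminus_fml_def)

lemma eval_diff [simp]: "eval_at r n (u - v) p = eval_at r n u p - eval_at r n v p"
  by (simp add: diff_conv_add_uminus del: add_uminus_conv_diff)

lemma eval_br [simp]: "eval_at r n (fbr u v) p = fbr (eval_at r n u p) (eval_at r n v p)"
  by (cases u rule: fml_cases, cases v rule: fml_cases)
     (simp add: fbr_abs eval_abs nsubst_nmul)

lemma eval_gen: "eval_at r n (gen i) p =
  (if i < r then gen i else if i < r + n then p ! (i - r) else 0)"
  by (auto simp: gen_def eval_abs nsubst_single nsmult_simps fml_abs_simps)

lemma eval_Fr [simp]: "u \<in> Fr r \<Longrightarrow> eval_at r n u p = u"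
  by (induct rule: Fr_induct) (auto simp: eval_gen)

lemma eval_in_Fr: "u \<in> Fr (r + n) \<Longrightarrow> p \<in> affine r n \<Longrightarrow> eval_at r n u p \<in> Fr r"
  by (induct rule: Fr_induct) (auto simp: eval_gen affine_def)

definition pvar :: "nat \<Rightarrow> 'k::field kpoly" where
  "pvar i = Poly_Mapping.single (Poly_Mapping.single i 1) 1"

section \<open>The Magnus embedding\<close>

lemma single_one_inj: "Poly_Mapping.single i (1 :: nat) = Poly_Mapping.single j 1 \<longleftrightarrow> i = j"
  by (metis keys_single singleton_inject zero_neq_one)

lemma kconst_simps:
  "kconst 0 = 0" "kconst 1 = 1" "kconst (a + b) = kconst a + kconst b"
  "kconst (a * b) = kconst a * kconst b" "kconst (- a) = - kconst a"
  by (simp_all add: kconst_def single_add mult_single single_uminus)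

lemma lookup_kconst_mult:
  "Poly_Mapping.lookup (kconst c * p) m = c * Poly_Mapping.lookup p m"
  unfolding kconst_def mult_map_scale_conv_mult[symmetric]
  by (simp add: Poly_Mapping.map.rep_eq when_def)

lemma single_as_pvar: "Poly_Mapping.single (Poly_Mapping.single i 1) c = kconst c * pvar i"
  by (simp add: kconst_def pvar_def mult_single)

text \<open>The Magnus embedding sends \<open>a\<^sub>i\<close> to \<open>(x\<^sub>i, e\<^sub>i)\<close> in the Lie algebra of pairs with bracket
  \<open>[(\<alpha>, v), (\<beta>, w)] = (0, \<beta> v - \<alpha> w)\<close>.\<close>

fun tlin :: "nat \<Rightarrow> mtree \<Rightarrow> 'k::field kpoly" where
  "tlin r (Leaf i) = (if i < r then pvar i else 0)"
| "tlin r (Node s t) = 0"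

fun tfox :: "nat \<Rightarrow> mtree \<Rightarrow> nat \<Rightarrow> 'k::field kpoly" where
  "tfox r (Leaf i) j = (if i = j then 1 else 0)"
| "tfox r (Node s t) j = tlin r t * tfox r s j - tlin r s * tfox r t j"

definition linext :: "(mtree \<Rightarrow> 'k::field kpoly) \<Rightarrow> 'k nalg \<Rightarrow> 'k kpoly" where
  "linext h f = (\<Sum>t\<in>Poly_Mapping.keys f. kconst (Poly_Mapping.lookup f t) * h t)"

lemma linext_add: "linext h (f + g) = linext h f + linext h g"
  unfolding linext_def
  by (subst setsum_keys_plus_distrib) (auto simp: kconst_simps algebra_simps)

lemma linext_zero [simp]: "linext h 0 = 0"
  by (simp add: linext_def)

lemma linext_single: "linext h (Poly_Mapping.single t c) = kconst c * h t"
  unfolding linext_def by (cases "c = 0") (auto simp: kconst_simps)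

lemma linext_nsmult: "linext h (nsmult c f) = kconst c * linext h f"
  by (induct f rule: poly_mapping_single_induct)
     (auto simp: linext_add linext_single nsmult_simps kconst_simps algebra_simps)

lemma linext_tlin_nmul: "linext (tlin r) (nmul f g) = 0"
proof (induct f rule: poly_mapping_single_induct)
  case (single s a)
  show ?case
    by (induct g rule: poly_mapping_single_induct)
       (auto simp: nmul_single nmul_add_right linext_add linext_single)
qed (auto simp: nmul_add_left linext_add)

lemma linext_tfox_nmul: "linext (\<lambda>t. tfox r t j) (nmul f g) =
  linext (tlin r) g * linext (\<lambda>t. tfox r t j) f - linext (tlin r) f * linext (\<lambda>t. tfox r t j) g"
proof (induct f rule: poly_mapping_single_induct)
  case (single s a)
  show ?case
    by (induct g rule: poly_mapping_single_induct)
       (auto simp: nmul_single nmul_add_right linext_add linext_single kconst_simps algebra_simps)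
qed (auto simp: nmul_add_left linext_add algebra_simps)

text \<open>The algebra of pairs is itself a metabelian Lie algebra, so the defining identities
  become polynomial identities. The two components are treated together because closure under
  products for \<open>tfox\<close> needs the vanishing of \<open>tlin\<close> too.\<close>

lemma linext_ideal:
  "f \<in> metab_ideal \<Longrightarrow> linext (tlin r) f = 0 \<and> linext (\<lambda>t. tfox r t j) f = 0"
  by (induct rule: metab_ideal.induct)
     (auto simp: linext_tlin_nmul linext_tfox_nmul linext_add linext_nsmult algebra_simps)

lemma linext_diff: "linext h (f - g) = linext h f - linext h g"
  by (metis linext_add add_diff_cancel_right' diff_add_cancel)

lemma linext_rep_abs:
  "linext (tlin r) (rep_fml (abs_fml f)) = linext (tlin r) f"
  "linext (\<lambda>t. tfox r t j) (rep_fml (abs_fml f)) = linext (\<lambda>t. tfox r t j) f"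
  using linext_ideal[OF rep_abs_fml[of f], of r] by (simp_all add: linext_diff)

text \<open>\<open>linpart\<close> reads the leaf coefficients of one chosen representative;
  identifying it with the first Magnus component shows that the choice does not matter.\<close>

lemma linpart_abs: "linpart r (abs_fml f) = linext (tlin r) f"
proof -
  have "(\<Sum>i<r. Poly_Mapping.single (Poly_Mapping.single i 1) (Poly_Mapping.lookup g (Leaf i)))
      = linext (tlin r) g" for g :: "'a nalg"
  proof (induct g rule: poly_mapping_single_induct)
    case (single t c)
    show ?case
    proof (cases t)
      case (Leaf k)
      have eq: "(\<Sum>i<r. Poly_Mapping.single (Poly_Mapping.single i 1)
              (Poly_Mapping.lookup (Poly_Mapping.single t c) (Leaf i)))
          = (\<Sum>i<r. if k = i then Poly_Mapping.single (Poly_Mapping.single i 1) c else 0)"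
        by (rule sum.cong) (auto simp: Leaf lookup_single when_def)
      show ?thesis
        unfolding eq by (simp add: Leaf linext_single single_as_pvar del: One_nat_def)
    next
      case Node then show ?thesis by (simp add: linext_single lookup_single)
    qed
  qed (auto simp: lookup_add single_add sum.distrib linext_add)
  then show ?thesis unfolding linpart_def by (simp only: linext_rep_abs)
qed

text \<open>The coefficient of \<open>e\<^sub>j\<close> in the Magnus image, the Lie analogue of a
  Fox derivative.\<close>

definition fox :: "nat \<Rightarrow> 'k::field fml \<Rightarrow> nat \<Rightarrow> 'k kpoly" where
  "fox r u j = linext (\<lambda>t. tfox r t j) (rep_fml u)"

lemma fox_abs: "fox r (abs_fml f) j = linext (\<lambda>t. tfox r t j) f"
  by (simp add: fox_def linext_rep_abs)

lemma linpart_simps [simp]: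
  "linpart r 0 = 0" "linpart r (u + v) = linpart r u + linpart r v"
  "linpart r (fsmult c u) = kconst c * linpart r u"
  "linpart r (fbr u v) = 0" "linpart r (gen i) = (if i < r then pvar i else 0)"
  by (cases u rule: fml_cases, cases v rule: fml_cases,
      simp add: linpart_abs fml_abs_simps fsmult_abs fbr_abs gen_def linext_add linext_nsmult
        linext_tlin_nmul linext_single kconst_simps)+

lemma fox_simps [simp]:
  "fox r 0 j = 0" "fox r (u + v) j = fox r u j + fox r v j"
  "fox r (fsmult c u) j = kconst c * fox r u j"
  "fox r (fbr u v) j = linpart r v * fox r u j - linpart r u * fox r v j"
  "fox r (gen i) j = (if i = j then 1 else 0)"
  by (cases u rule: fml_cases, cases v rule: fml_cases,
      simp add: linpart_abs fox_abs fml_abs_simps fsmult_abs fbr_abs gen_def linext_add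
        linext_nsmult linext_tfox_nmul linext_single kconst_simps)+

lemma linpart_minus [simp]: "linpart r (- u) = - linpart r u"
  and linpart_diff [simp]: "linpart r (u - v) = linpart r u - linpart r v"
  and fox_minus [simp]: "fox r (- u) j = - fox r u j"
  and fox_diff [simp]: "fox r (u - v) j = fox r u j - fox r v j"
  by (simp_all add: uminus_fml_def minus_fml_def kconst_simps)

lemma linpart_sum: "linpart r (sum f A) = (\<Sum>i\<in>A. linpart r (f i))"
  by (induct A rule: infinite_finite_induct) auto

text \<open>The derived algebra of \<open>Fr r\<close>, generated by the commutators of generators
  as a module over the polynomial ring: rule \<open>br\<close> is multiplication by a variable.
  \<open>Fr_linpart_zero\<close> identifies it with the kernel of \<open>linpart\<close>.\<close>

inductive_set DF :: "nat \<Rightarrow> 'k::field fml set" for r where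
  zero: "0 \<in> DF r"
| comm: "i < r \<Longrightarrow> j < r \<Longrightarrow> fbr (gen i) (gen j) \<in> DF r"
| add: "u \<in> DF r \<Longrightarrow> v \<in> DF r \<Longrightarrow> u + v \<in> DF r"
| smult: "u \<in> DF r \<Longrightarrow> fsmult c u \<in> DF r"
| br: "u \<in> DF r \<Longrightarrow> l < r \<Longrightarrow> fbr u (gen l) \<in> DF r"

lemma DF_uminus: "u \<in> DF r \<Longrightarrow> - u \<in> DF r"
  by (simp add: uminus_fml_def DF.smult)

lemma DF_diff: "u \<in> DF r \<Longrightarrow> v \<in> DF r \<Longrightarrow> u - v \<in> DF r"
  by (metis diff_conv_add_uminus DF.add DF_uminus)

lemma DF_sum: "(\<And>i. i \<in> A \<Longrightarrow> f i \<in> DF r) \<Longrightarrow> sum f A \<in> DF r"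
  by (induct A rule: infinite_finite_induct) (auto intro: DF.intros)

lemma DF_subset_Fr: "DF r \<subseteq> Fr r"
proof
  fix w :: "'a fml" assume "w \<in> DF r" then show "w \<in> Fr r" by induct auto
qed

lemma DF_linpart [simp]: "w \<in> DF r \<Longrightarrow> linpart r w = 0"
  by (induct rule: DF.induct) auto

text \<open>The centraliser of all commutators. It contains every bracket and every
  \<open>DF r\<close>, and does not mention \<open>r\<close>, which makes it a convenient domain for
  the commuting action of the generators.\<close>

definition cent :: "'k::field fml set" where
  "cent = {w. \<forall>y z. fbr w (fbr y z) = 0}"

lemma cent_simps:
  "0 \<in> cent" "u \<in> cent \<Longrightarrow> v \<in> cent \<Longrightarrow> u + v \<in> cent"
  "u \<in> cent \<Longrightarrow> fsmult c u \<in> cent" "fbr u v \<in> cent"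
  by (auto simp: cent_def fbr_add_left fbr_smult_left fsmult_simps)

lemma DF_subset_cent: "DF r \<subseteq> cent"
proof
  fix w :: "'a fml" assume "w \<in> DF r" then show "w \<in> cent" by induct (auto simp: cent_simps)
qed

text \<open>In the Jacobi identity the term \<open>fbr (fbr u v) w\<close> vanishes. This is what
  turns bracketing with generators into an action of a commutative polynomial ring.\<close>

lemma cent_commute: "w \<in> cent \<Longrightarrow> fbr (fbr w u) v = fbr (fbr w v) u"
  using fbr_jacobi[of w u v] fbr_anti[of "fbr u v" w] fbr_anti[of v w]
  by (simp add: cent_def fbr_minus)

lemma Fr_decomp:
  assumes "u \<in> Fr r"
  shows "\<exists>v\<in>DF r. \<exists>c. u = v + (\<Sum>i<r. fsmult (c i) (gen i))"
  using assms
proof (induct rule: Fr_induct)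
  case zero
  show ?case
    by (rule bexI[OF _ DF.zero], rule exI[of _ "\<lambda>_. 0"]) (simp add: fsmult_simps)
next
  case (gen i)
  have "gen i = (\<Sum>j<r. fsmult (if j = i then 1 else 0) (gen j))"
    using gen by (simp add: if_distrib[of "\<lambda>c. fsmult c _"] fsmult_simps cong: if_cong)
  then show ?case
    by (intro bexI[OF _ DF.zero] exI[of _ "\<lambda>j. if j = i then 1 else 0"]) simp
next
  case (add u v)
  then obtain u' v' c d where "u' \<in> DF r" "v' \<in> DF r"
    "u = u' + (\<Sum>i<r. fsmult (c i) (gen i))" "v = v' + (\<Sum>i<r. fsmult (d i) (gen i))" by blast
  then show ?case
    by (intro bexI[of _ "u' + v'"] exI[of _ "\<lambda>i. c i + d i"])
       (auto simp: fsmult_simps sum.distrib intro: DF.add)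
next
  case (smult u a)
  then obtain u' c where "u' \<in> DF r" "u = u' + (\<Sum>i<r. fsmult (c i) (gen i))" by blast
  then show ?case
    by (intro bexI[of _ "fsmult a u'"] exI[of _ "\<lambda>i. a * c i"])
       (auto simp: fsmult_simps fsmult_sum intro: DF.smult)
next
  case (br u v)
  then obtain u' v' c d where uv: "u' \<in> DF r" "v' \<in> DF r"
    "u = u' + (\<Sum>i<r. fsmult (c i) (gen i))" "v = v' + (\<Sum>i<r. fsmult (d i) (gen i))" by blast
  \<comment> \<open>The bracket splits into four parts: \<open>fbr u' v'\<close> is zero, and the
    facts 1, 2 and 3 place the two mixed parts and the bracket of the two linear sums in
    \<open>DF r\<close>.\<close>
  have 1: "fbr x (\<Sum>i<r. fsmult (e i) (gen i)) \<in> DF r" if "x \<in> DF r" for x :: "'a fml" and e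
  proof -
    have "fbr x (sum f A) = (\<Sum>i\<in>A. fbr x (f i))" for f :: "nat \<Rightarrow> 'a fml" and A
      by (induct A rule: infinite_finite_induct) (auto simp: fbr_add_right)
    then show ?thesis using that
      by (auto simp: fbr_smult_right intro!: DF_sum DF.smult DF.br)
  qed
  have 2: "fbr (\<Sum>i<r. fsmult (e i) (gen i)) y \<in> DF r"
    if "\<And>i. i < r \<Longrightarrow> fbr (gen i) y \<in> DF r" for y e
    using that by (auto simp: fbr_sum_left fbr_smult_left intro!: DF_sum DF.smult)
  have 3: "fbr (gen i) (\<Sum>i<r. fsmult (d i) (gen i)) \<in> DF r" if "i < r" for i
    using that by (subst fbr_anti) (auto intro!: DF_uminus 2 DF.comm)
  have "fbr u' v' = 0" using uv(2,1)
  proof (induct rule: DF.induct)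
    case (add x y) then show ?case by (simp add: fbr_add_right)
  next
    case (smult x y) then show ?case by (simp add: fbr_smult_right fsmult_simps)
  qed (use DF_subset_cent[of r] in \<open>auto simp: cent_def\<close>)
  moreover have "fbr (gen i) v' \<in> DF r" if "i < r" for i
    using that uv(2) by (subst fbr_anti) (auto intro: DF_uminus DF.br)
  ultimately have "fbr u v \<in> DF r"
    unfolding uv(3,4) fbr_add_left fbr_add_right
    using 1[OF uv(1), of d] 2[of v' c] 2[OF 3, of c] by (auto intro: DF.add)
  then show ?case
    by (intro bexI[of _ "fbr u v"] exI[of _ "\<lambda>_. 0"]) (auto simp: fsmult_simps)
qed

text \<open>The coefficient of \<open>gen j\<close> in the decomposition is the coefficient of the
  j-th variable in \<open>linpart r u\<close>.\<close>

lemma Fr_linpart_zero: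
  assumes "u \<in> Fr r" "linpart r u = 0" shows "u \<in> DF r"
proof -
  obtain v c where v: "v \<in> DF r" "u = v + (\<Sum>i<r. fsmult (c i) (gen i))"
    using Fr_decomp[OF assms(1)] by blast
  have 0: "(\<Sum>i<r. kconst (c i) * pvar i) = 0"
    using assms(2) v by (simp add: linpart_sum)
  have "c j = 0" if "j < r" for j
  proof -
    have "c j = (\<Sum>i<r. if i = j then c i else 0)" using that by simp
    also have "\<dots> = (\<Sum>i<r. Poly_Mapping.lookup (kconst (c i) * pvar i) (Poly_Mapping.single j 1))"
      by (rule sum.cong)
         (auto simp: lookup_kconst_mult pvar_def lookup_single when_def single_one_inj simp del: One_nat_def)
    also have "\<dots> = 0" by (simp add: lookup_sum[symmetric] 0)
    finally show ?thesis .
  qed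
  then show ?thesis using v by (simp add: fsmult_simps)
qed

section \<open>The polynomial ring \<open>Rring r\<close> and its action on the derived
  algebra\<close>

lemma Rring_simps [simp]:
  "monoid.mult (Rring r) = (*)" "one (Rring r) = 1" "zero (Rring r) = 0" "add (Rring r) = (+)"
  by (simp_all add: Rring_def)

lemma Rring_carrier_iff: "p \<in> carrier (Rring r) \<longleftrightarrow>
  (\<forall>m\<in>Poly_Mapping.keys p. Poly_Mapping.keys m \<subseteq> {..<r})"
  by (auto simp: Rring_def)

lemma Rring_pvar [simp, intro]: "i < r \<Longrightarrow> pvar i \<in> carrier (Rring r)"
  and Rring_kconst [simp, intro]: "kconst c \<in> carrier (Rring r)"
  and Rring_zero [simp, intro]: "0 \<in> carrier (Rring r)"
  by (auto simp: Rring_carrier_iff pvar_def kconst_def split: if_splits)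

lemma Rring_one [simp, intro]: "1 \<in> carrier (Rring r)"
  by (metis Rring_kconst kconst_simps(2))

lemma Rring_add [simp, intro]:
  "p \<in> carrier (Rring r) \<Longrightarrow> q \<in> carrier (Rring r) \<Longrightarrow> p + q \<in> carrier (Rring r)"
  unfolding Rring_carrier_iff using keys_add[of p q] by blast

lemma Rring_mult [simp, intro]:
  assumes "p \<in> carrier (Rring r)" "q \<in> carrier (Rring r)" shows "p * q \<in> carrier (Rring r)"
  unfolding Rring_carrier_iff
proof
  fix m assume "m \<in> Poly_Mapping.keys (p * q)"
  then obtain a b where "m = a + b" "a \<in> Poly_Mapping.keys p" "b \<in> Poly_Mapping.keys q"
    using keys_mult[of p q] by blast
  then show "Poly_Mapping.keys m \<subseteq> {..<r}"
    using assms keys_add[of a b] unfolding Rring_carrier_iff by blast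
qed

lemma Rring_uminus [simp, intro]: "p \<in> carrier (Rring r) \<Longrightarrow> - p \<in> carrier (Rring r)"
  unfolding Rring_carrier_iff by simp

lemma Rring_linpart [simp, intro]: "linpart r u \<in> carrier (Rring r)"
proof -
  have "(\<Sum>i\<in>A. f i) \<in> carrier (Rring r)" if "\<And>i. i \<in> A \<Longrightarrow> f i \<in> carrier (Rring r)"
    for A :: "nat set" and f :: "nat \<Rightarrow> 'a kpoly"
    using that by (induct A rule: infinite_finite_induct) auto
  note sum = this
  show ?thesis unfolding linpart_def single_as_pvar by (rule sum) auto
qed

lemma Rring_power [simp, intro]: "p \<in> carrier (Rring r) \<Longrightarrow> p ^ e \<in> carrier (Rring r)"
  by (induct e) auto

text \<open>One variable is multiplied on at a time, to match bracketing with one generator at a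
  time.\<close>

lemma Rring_induct [consumes 1, case_names const var add]:
  fixes p :: "'k::field kpoly"
  assumes "p \<in> carrier (Rring r)" "\<And>c. P (kconst c)"
    "\<And>i p. i < r \<Longrightarrow> p \<in> carrier (Rring r) \<Longrightarrow> P p \<Longrightarrow> P (pvar i * p)"
    "\<And>p q. p \<in> carrier (Rring r) \<Longrightarrow> q \<in> carrier (Rring r) \<Longrightarrow> P p \<Longrightarrow> P q \<Longrightarrow> P (p + q)"
  shows "P p"
proof -
  \<comment> \<open>Induction on the total degree of the monomial; all its variables lie below
    \<open>r\<close>, so the sum over \<open>i < r\<close> is that degree.\<close>
  have mono: "P (Poly_Mapping.single m c) \<and> Poly_Mapping.single m c \<in> carrier (Rring r)"
    if "Poly_Mapping.keys m \<subseteq> {..<r}" for m c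
    using that
  proof (induct "\<Sum>i<r. Poly_Mapping.lookup m i" arbitrary: m rule: less_induct)
    case less
    show ?case
    proof (cases "m = 0")
      case True then show ?thesis using assms(2)[of c] Rring_kconst[of c r] by (simp add: kconst_def)
    next
      case False
      then obtain i where i: "i \<in> Poly_Mapping.keys m" by fastforce
      then have ir: "i < r" using less by auto
      define m' where "m' = m - Poly_Mapping.single i 1"
      have m: "m = Poly_Mapping.single i 1 + m'"
        by (rule poly_mapping_eqI)
           (use i in \<open>auto simp: m'_def lookup_add lookup_minus lookup_single when_def in_keys_iff\<close>)
      have "Poly_Mapping.keys m' \<subseteq> Poly_Mapping.keys m"
        by (auto simp: m'_def in_keys_iff lookup_minus)
      moreover have "(\<Sum>i<r. Poly_Mapping.lookup m' i) < (\<Sum>i<r. Poly_Mapping.lookup m i)"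
        by (subst m, rule sum_strict_mono_ex1) (use ir in \<open>auto simp: lookup_add lookup_single intro!: bexI[of _ i]\<close>)
      ultimately have "P (Poly_Mapping.single m' c)" "Poly_Mapping.single m' c \<in> carrier (Rring r)"
        using less by auto
      moreover have "Poly_Mapping.single m c = pvar i * Poly_Mapping.single m' c"
        by (simp add: pvar_def mult_single m)
      ultimately show ?thesis using assms(3)[OF ir] ir by (metis Rring_mult Rring_pvar)
    qed
  qed
  have sum: "P (\<Sum>m\<in>A. Poly_Mapping.single m (Poly_Mapping.lookup p m)) \<and>
      (\<Sum>m\<in>A. Poly_Mapping.single m (Poly_Mapping.lookup p m)) \<in> carrier (Rring r)"
    if "finite A" "A \<subseteq> Poly_Mapping.keys p" for A
    using that
  proof (induct A)
    case empty then show ?case using assms(2)[of 0] by (simp add: kconst_simps)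
  next
    case (insert m A)
    moreover have "Poly_Mapping.keys m \<subseteq> {..<r}"
      using insert assms(1) by (auto simp: Rring_carrier_iff)
    ultimately show ?case using mono[of m] assms(4) by auto
  qed
  have "p = (\<Sum>m\<in>Poly_Mapping.keys p. Poly_Mapping.single m (Poly_Mapping.lookup p m))"
    by (rule poly_mapping_eqI)
       (simp add: lookup_sum lookup_single when_def in_keys_iff)
  then show ?thesis using sum[of "Poly_Mapping.keys p"] by (metis finite_keys subset_refl)
qed

text \<open>Elements of \<open>DF r\<close> have linear part 0, so \<open>fbr w' (gen i)\<close> has
  the coordinates of \<open>w'\<close> times the i-th variable. The image of \<open>DF r\<close> is
  thus an R-submodule, a source of elements with prescribed coordinates.\<close>

lemma DF_fox_scale:
  assumes "p \<in> carrier (Rring r)" "w \<in> DF r"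
  shows "\<exists>w'\<in>DF r. \<forall>j. fox r w' j = p * fox r w j"
  using assms(1)
proof (induct rule: Rring_induct)
  case (const c)
  show ?case using assms(2) by (intro bexI[of _ "fsmult c w"]) (auto intro: DF.smult)
next
  case (var i p)
  then obtain w' where "w' \<in> DF r" "\<forall>j. fox r w' j = p * fox r w j" by blast
  then show ?case using var(1) by (intro bexI[of _ "fbr w' (gen i)"]) (auto intro: DF.br)
next
  case (add p q)
  then obtain u v where "u \<in> DF r" "\<forall>j. fox r u j = p * fox r w j"
    "v \<in> DF r" "\<forall>j. fox r v j = q * fox r w j" by blast
  then show ?case by (intro bexI[of _ "u + v"]) (auto simp: algebra_simps intro: DF.add)
qed

text \<open>Extending the action of the generators by the identity outside of \<open>cent\<close> makes it commute
  everywhere, so that it can be folded over a multiset.\<close>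

definition adx :: "nat \<Rightarrow> 'k::field fml \<Rightarrow> 'k fml" where
  "adx l w = (if w \<in> cent then fbr w (gen l) else w)"

interpretation adx: comp_fun_commute adx
  by standard (auto simp: adx_def fun_eq_iff cent_simps cent_commute)

text \<open>The action of the monomial with exponents \<open>m\<close> on \<open>cent\<close>. The
  exponent function is read as a multiset of variables, so that no order of bracketing has to be
  chosen.\<close>

definition monact :: "(nat \<Rightarrow>\<^sub>0 nat) \<Rightarrow> 'k::field fml \<Rightarrow> 'k fml" where
  "monact m w = fold_mset adx w (Abs_multiset (Poly_Mapping.lookup m))"

lemma count_lookup: "count (Abs_multiset (Poly_Mapping.lookup m)) = Poly_Mapping.lookup (m :: nat \<Rightarrow>\<^sub>0 nat)"
  using finite_lookup[of m] by (simp add: Abs_multiset_inverse)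

lemma monact_zero [simp]: "monact 0 w = w"
proof -
  have "Abs_multiset (Poly_Mapping.lookup (0 :: nat \<Rightarrow>\<^sub>0 nat)) = {#}"
    by (rule multiset_eqI) (simp only: count_lookup, simp)
  then show ?thesis by (simp add: monact_def)
qed

lemma monact_var:
  assumes "w \<in> cent"
  shows "monact (m + Poly_Mapping.single l 1) w = monact m (fbr w (gen l))"
proof -
  have "Abs_multiset (Poly_Mapping.lookup (m + Poly_Mapping.single l 1))
      = add_mset l (Abs_multiset (Poly_Mapping.lookup m))"
    by (rule multiset_eqI)
       (simp only: count_lookup count_add_mset, auto simp: lookup_add lookup_single when_def)
  then show ?thesis using assms
    by (simp add: monact_def adx.fold_mset_fun_left_comm) (simp add: adx_def)
qed

lemma adx_cent: "w \<in> cent \<Longrightarrow> adx l w = fbr w (gen l)"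
  by (simp add: adx_def)

lemma fold_adx_linear:
  assumes "u \<in> cent" "v \<in> cent"
  shows "fold_mset adx u A \<in> cent"
    "fold_mset adx (u + v) A = fold_mset adx u A + fold_mset adx v A"
    "fold_mset adx (fsmult c u) A = fsmult c (fold_mset adx u A)"
proof -
  have *: "fold_mset adx u A \<in> cent" if "u \<in> cent" for u :: "'a fml" and A
    using that by (induct A) (auto simp: adx_cent cent_simps)
  show "fold_mset adx u A \<in> cent" using * assms by auto
  show "fold_mset adx (u + v) A = fold_mset adx u A + fold_mset adx v A"
    by (induct A) (auto simp: adx_cent cent_simps * assms fbr_add_left)
  show "fold_mset adx (fsmult c u) A = fsmult c (fold_mset adx u A)"
    by (induct A) (auto simp: adx_cent cent_simps * assms fbr_smult_left)
qed

lemma monact_linear: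
  assumes "u \<in> cent" "v \<in> cent"
  shows "monact m (u + v) = monact m u + monact m v"
    "monact m (fsmult c u) = fsmult c (monact m u)"
    "monact m (u - v) = monact m u - monact m v"
  using fold_adx_linear(2,3)[OF assms] fold_adx_linear(3)[OF assms(2,2)]
    fold_adx_linear(2)[OF assms(1) cent_simps(3)[OF assms(2)]]
  by (auto simp: monact_def minus_fml_def)

text \<open>The value at \<open>e\<^sub>i x\<^sup>m\<close> of a linear left inverse of the Magnus embedding on the derived
  algebra. The basis commutators \<open>[a\<^sub>i, a\<^sub>k] x\<^sup>m\<close> with \<open>k < i\<close> and \<open>k\<close> at most every variable of
  \<open>m\<close> are recognised by their leading term \<open>e\<^sub>i x\<^sub>k x\<^sup>m\<close>.\<close>

definition magnus_basis :: "nat \<Rightarrow> (nat \<Rightarrow>\<^sub>0 nat) \<Rightarrow> 'k::field fml" where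
  "magnus_basis i m = (let k = Min (Poly_Mapping.keys m) in
     if m \<noteq> 0 \<and> k < i then monact (m - Poly_Mapping.single k 1) (fbr (gen i) (gen k)) else 0)"

lemma magnus_basis_less:
  assumes "k < i" "Poly_Mapping.keys m \<subseteq> {k..}"
  shows "magnus_basis i (m + Poly_Mapping.single k 1) = monact m (fbr (gen i) (gen k))"
proof -
  have "k \<in> Poly_Mapping.keys (m + Poly_Mapping.single k 1)"
    by (simp add: in_keys_iff lookup_add)
  moreover have "Poly_Mapping.keys (m + Poly_Mapping.single k 1) \<subseteq> {k..}"
    using assms(2) keys_add[of m "Poly_Mapping.single k 1"] by auto
  ultimately have "Min (Poly_Mapping.keys (m + Poly_Mapping.single k 1)) = k"
    by (auto intro!: Min_eqI)
  moreover have "m + Poly_Mapping.single k 1 \<noteq> 0"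
    using \<open>k \<in> Poly_Mapping.keys (m + Poly_Mapping.single k 1)\<close> by auto
  ultimately show ?thesis using assms(1) by (simp add: magnus_basis_def Let_def)
qed

lemma magnus_basis_ge:
  assumes "Poly_Mapping.keys m \<subseteq> {i..}" shows "magnus_basis i m = 0"
proof -
  have "\<not> Min (Poly_Mapping.keys m) < i" if "m \<noteq> 0"
    using assms that by (auto simp: Min_less_iff)
  then show ?thesis by (auto simp: magnus_basis_def Let_def)
qed

text \<open>The Magnus image of the right-hand side is \<open>e\<^sub>i x\<^sub>j x\<^sup>m -
  e\<^sub>j x\<^sub>i x\<^sup>m\<close>, so this is the left-inverse property on all commutators
  times monomials, including those outside the basis.\<close>

lemma magnus_basis_commutator:
  "magnus_basis i (m + Poly_Mapping.single j 1) - magnus_basis j (m + Poly_Mapping.single i 1)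
    = monact m (fbr (gen i) (gen j) :: 'k::field fml)"
proof -
  let ?x = "\<lambda>i. Poly_Mapping.single i (1 :: nat)"
  have keysx: "Poly_Mapping.keys (m + ?x i) \<subseteq> {k..}"
    if "Poly_Mapping.keys m \<subseteq> {k..}" "k \<le> i" for m i k
    using keys_add[of m "?x i"] that by (auto split: if_splits)
  show ?thesis
  proof (cases "\<exists>k\<in>Poly_Mapping.keys m. k < i \<and> k < j")
    case True
    \<comment> \<open>This \<open>k\<close> is the least variable of both monomials, so both are
      expanded with the same \<open>k\<close>; what remains is the Jacobi identity for
      \<open>gen i\<close>, \<open>gen j\<close>, \<open>gen k\<close>.\<close>
    define k where "k = Min (Poly_Mapping.keys m)"
    have ne: "Poly_Mapping.keys m \<noteq> {}" using True by auto
    have k: "k \<in> Poly_Mapping.keys m" "k < i" "k < j" "Poly_Mapping.keys m \<subseteq> {k..}"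
      using True ne unfolding k_def by (auto simp: Min_less_iff)
    define m' where "m' = m - ?x k"
    have m: "m = m' + ?x k"
      by (rule poly_mapping_eqI)
         (use k(1) in \<open>auto simp: m'_def lookup_add lookup_minus lookup_single when_def in_keys_iff\<close>)
    have m'k: "Poly_Mapping.keys m' \<subseteq> {k..}"
      using k(4) by (auto simp: m'_def in_keys_iff lookup_minus subset_eq)
    have mb: "magnus_basis a (m + ?x b) = monact m' (fbr (fbr (gen a) (gen k)) (gen b :: 'k fml))"
      if "k < a" "k < b" for a b
    proof -
      have "m + ?x b = (m' + ?x b) + ?x k" by (simp add: m algebra_simps)
      then have "magnus_basis a (m + ?x b) = monact (m' + ?x b) (fbr (gen a) (gen k))"
        using magnus_basis_less[OF that(1) keysx[OF m'k, of b]] that by simp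
      then show ?thesis by (simp add: monact_var cent_simps del: One_nat_def)
    qed
    have "magnus_basis i (m + ?x j) - magnus_basis j (m + ?x i)
      = monact m' (fbr (fbr (gen i) (gen k)) (gen j) - fbr (fbr (gen j) (gen k)) (gen i :: 'k fml))"
      by (simp only: mb[OF k(2,3)] mb[OF k(3,2)] monact_linear(3)[OF cent_simps(4) cent_simps(4)])
    also have "fbr (fbr (gen i) (gen k)) (gen j) - fbr (fbr (gen j) (gen k)) (gen i)
        = fbr (fbr (gen i) (gen j)) (gen k :: 'k fml)"
    proof -
      have "fbr (fbr (gen k) (gen i)) (gen j) = - fbr (fbr (gen i) (gen k)) (gen j :: 'k fml)"
        by (subst fbr_anti[of "gen k"]) (simp add: fbr_minus)
      then have "fbr (fbr (gen i) (gen j)) (gen k) + fbr (fbr (gen j) (gen k)) (gen i)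
          - fbr (fbr (gen i) (gen k)) (gen j :: 'k fml) = 0"
        using fbr_jacobi[of "gen i" "gen j" "gen k :: 'k fml"] by simp
      then show ?thesis by (simp add: algebra_simps)
    qed
    also have "monact m' \<dots> = monact m (fbr (gen i) (gen j))"
      by (simp add: m monact_var cent_simps del: One_nat_def)
    finally show ?thesis .
  next
    case False
    \<comment> \<open>No variable of \<open>m\<close> precedes \<open>min i j\<close>, so for
      distinct indices the term of the larger index is a basis commutator and the other one is
      0.\<close>
    then have F: "Poly_Mapping.keys m \<subseteq> {min i j..}" by force
    consider "i = j" | "j < i" | "i < j" by linarith
    then show ?thesis
    proof cases
      case 1
      have "monact m 0 = monact m (0 + 0)" by simp
      then have "monact m 0 = 0" by (subst (asm) monact_linear(1)) (auto simp: cent_simps)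
      then show ?thesis using 1 by simp
    next
      case 2
      then have "magnus_basis i (m + ?x j) = monact m (fbr (gen i) (gen j) :: 'k fml)"
        using F by (intro magnus_basis_less) auto
      moreover have "magnus_basis j (m + ?x i) = (0 :: 'k fml)"
        using 2 F by (intro magnus_basis_ge keysx) auto
      ultimately show ?thesis by simp
    next
      case 3
      then have "magnus_basis j (m + ?x i) = monact m (fbr (gen j) (gen i) :: 'k fml)"
        using F by (intro magnus_basis_less) auto
      moreover have "magnus_basis i (m + ?x j) = (0 :: 'k fml)"
        using 3 F by (intro magnus_basis_ge keysx) auto
      moreover have "monact m (fsmult (-1) (fbr (gen j) (gen i))) = - monact m (fbr (gen j) (gen i) :: 'k fml)"
        unfolding uminus_fml_def by (rule monact_linear(2)[of _ 0]) (auto simp: cent_simps)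
      ultimately show ?thesis
        by (subst fbr_anti) (simp add: uminus_fml_def)
    qed
  qed
qed

text \<open>The k-linear extension of \<open>magnus_basis\<close>. It is not R-linear:
  \<open>e\<^sub>i\<close> goes to 0, while its multiple by \<open>x\<^sub>k\<close> with
  \<open>k < i\<close> goes to a commutator.\<close>

definition unmagnus :: "nat \<Rightarrow> (nat \<Rightarrow> 'k::field kpoly) \<Rightarrow> 'k fml" where
  "unmagnus r v = (\<Sum>i<r. \<Sum>m\<in>Poly_Mapping.keys (v i).
     fsmult (Poly_Mapping.lookup (v i) m) (magnus_basis i m))"

lemma unmagnus_add: "unmagnus r (\<lambda>i. v i + w i) = unmagnus r v + unmagnus r w"
  unfolding unmagnus_def
  by (subst setsum_keys_plus_distrib) (auto simp: fsmult_simps sum.distrib)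

lemma unmagnus_kconst: "unmagnus r (\<lambda>i. kconst c * v i) = fsmult c (unmagnus r v)"
proof (cases "c = 0")
  case False
  then have "Poly_Mapping.keys (kconst c * p) = Poly_Mapping.keys p" for p :: "'a kpoly"
    by (auto simp: in_keys_iff lookup_kconst_mult)
  then show ?thesis
    by (simp add: unmagnus_def lookup_kconst_mult fsmult_sum fsmult_simps)
qed (simp add: kconst_simps unmagnus_def fsmult_simps)

lemma unmagnus_single:
  "i < r \<Longrightarrow> unmagnus r (\<lambda>l. if l = i then Poly_Mapping.single m 1 else 0) = magnus_basis i m"
  unfolding unmagnus_def
  by (subst sum.remove[of _ i]) (auto simp: fsmult_simps intro!: sum.neutral)

text \<open>As \<open>unmagnus\<close> is only k-linear, a monomial \<open>m\<close> is carried
  through the induction: a bracket with \<open>gen l\<close> is absorbed by multiplying the monomial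
  by the l-th variable.\<close>

lemma unmagnus_fox:
  assumes "w \<in> DF r"
  shows "unmagnus r (\<lambda>j. Poly_Mapping.single m 1 * fox r w j) = monact m w"
  using assms
proof (induct arbitrary: m rule: DF.induct)
  case zero
  have "monact m (0 :: 'a fml) = monact m (0 - 0)" by simp
  then have "monact m (0 :: 'a fml) = 0" by (subst (asm) monact_linear(3)) (auto simp: cent_simps)
  then show ?case by (simp add: unmagnus_def)
next
  case (comm i j)
  have *: "Poly_Mapping.single m 1 * pvar i = (Poly_Mapping.single (m + Poly_Mapping.single i 1) 1 :: 'a kpoly)" for i
    by (simp add: pvar_def mult_single)
  have "(\<lambda>l. Poly_Mapping.single m 1 * fox r (fbr (gen i) (gen j)) l)
    = (\<lambda>l. (if l = i then Poly_Mapping.single (m + Poly_Mapping.single j 1) 1 else 0) +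
        kconst (-1 :: 'a) * (if l = j then Poly_Mapping.single (m + Poly_Mapping.single i 1) 1 else 0))"
    using comm by (auto simp: fun_eq_iff right_diff_distrib * kconst_simps)
  then have "unmagnus r (\<lambda>l. Poly_Mapping.single m 1 * fox r (fbr (gen i) (gen j) :: 'a fml) l)
    = magnus_basis i (m + Poly_Mapping.single j 1) - magnus_basis j (m + Poly_Mapping.single i 1)"
    using comm by (simp add: unmagnus_add unmagnus_kconst unmagnus_single minus_fml_def)
  then show ?case by (simp only: magnus_basis_commutator)
next
  case (add u v)
  then have "u \<in> cent" "v \<in> cent" using DF_subset_cent by auto
  then show ?case using add by (simp add: distrib_left unmagnus_add monact_linear)
next
  case (smult u c)
  then have "u \<in> cent" using DF_subset_cent by auto
  moreover have "(\<lambda>j. Poly_Mapping.single m 1 * fox r (fsmult c u) j)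
     = (\<lambda>j. kconst c * (Poly_Mapping.single m 1 * fox r u j))"
    by (auto simp: algebra_simps)
  ultimately show ?case using smult by (simp add: unmagnus_kconst monact_linear)
next
  case (br u l)
  then have "u \<in> cent" using DF_subset_cent by auto
  moreover have "(\<lambda>j. Poly_Mapping.single m 1 * fox r (fbr u (gen l)) j)
     = (\<lambda>j. Poly_Mapping.single (m + Poly_Mapping.single l 1) 1 * fox r u j)"
    using br by (auto simp: pvar_def mult_single mult.assoc[symmetric])
  ultimately show ?case using br(2)[of "m + Poly_Mapping.single l 1"] by (simp add: monact_var del: One_nat_def)
qed

text \<open>Injectivity of the Magnus embedding on the derived algebra: at \<open>m = 0\<close> the
  left inverse recovers \<open>w\<close> itself.\<close>

lemma DF_fox_eq_zero:
  assumes "w \<in> DF r" "\<And>j. fox r w j = 0" shows "w = 0"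
proof -
  have "w = unmagnus r (\<lambda>j. 0)"
    using unmagnus_fox[OF assms(1), of 0] assms(2) by simp
  then show ?thesis by (simp add: unmagnus_def)
qed

lemma Fr_eq_zero_iff:
  "u \<in> Fr r \<Longrightarrow> u = 0 \<longleftrightarrow> linpart r u = 0 \<and> (\<forall>j. fox r u j = 0)"
  using Fr_linpart_zero DF_fox_eq_zero by (metis fox_simps(1) linpart_simps(1))

section \<open>Separating functionals on finitely generated modules\<close>

locale plain_module = module R M
  for R :: "('a, 'b) ring_scheme" (structure) and M :: "('a, 'm) module" (structure)
begin

definition lcomb :: "('m \<Rightarrow> 'a) \<Rightarrow> 'm set \<Rightarrow> 'm" where
  "lcomb c B = finsum M (\<lambda>b. c b \<odot>\<^bsub>M\<^esub> b) B"

lemma lcomb_closed [simp]: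
  "B \<subseteq> carrier M \<Longrightarrow> c \<in> B \<rightarrow> carrier R \<Longrightarrow> lcomb c B \<in> carrier M"
  unfolding lcomb_def by (rule M.finsum_closed) auto

lemma lcomb_add:
  assumes "B \<subseteq> carrier M" "c \<in> B \<rightarrow> carrier R" "d \<in> B \<rightarrow> carrier R"
  shows "lcomb (\<lambda>b. c b \<oplus> d b) B = lcomb c B \<oplus>\<^bsub>M\<^esub> lcomb d B"
proof -
  have "lcomb (\<lambda>b. c b \<oplus> d b) B = finsum M (\<lambda>b. c b \<odot>\<^bsub>M\<^esub> b \<oplus>\<^bsub>M\<^esub> d b \<odot>\<^bsub>M\<^esub> b) B"
    unfolding lcomb_def using assms by (intro M.finsum_cong') (auto simp: smult_l_distr Pi_iff subset_iff)
  also have "\<dots> = lcomb c B \<oplus>\<^bsub>M\<^esub> lcomb d B"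
    unfolding lcomb_def using assms by (intro M.finsum_addf) auto
  finally show ?thesis .
qed

lemma lcomb_smult:
  assumes "finite B" "B \<subseteq> carrier M" "c \<in> B \<rightarrow> carrier R" "a \<in> carrier R"
  shows "a \<odot>\<^bsub>M\<^esub> lcomb c B = lcomb (\<lambda>b. a \<otimes> c b) B"
proof -
  have "a \<odot>\<^bsub>M\<^esub> lcomb c B = finsum M (\<lambda>b. a \<odot>\<^bsub>M\<^esub> (c b \<odot>\<^bsub>M\<^esub> b)) B"
    unfolding lcomb_def using assms by (intro finsum_smult_ldistr) auto
  also have "\<dots> = lcomb (\<lambda>b. a \<otimes> c b) B"
    unfolding lcomb_def using assms by (intro M.finsum_cong') (auto simp: smult_assoc1 Pi_iff subset_iff)
  finally show ?thesis .
qed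

lemma lcomb_extend:
  assumes "finite B" "B \<subseteq> carrier M" "T \<subseteq> B" "c \<in> T \<rightarrow> carrier R"
  shows "lcomb c T = lcomb (\<lambda>b. if b \<in> T then c b else \<zero>) B"
  unfolding lcomb_def using assms
  by (intro M.add.finprod_mono_neutral_cong_left) (auto simp: subset_iff Pi_iff)

lemma lcomb_single:
  assumes "finite B" "B \<subseteq> carrier M" "s \<in> B" "a \<in> carrier R"
  shows "lcomb (\<lambda>b. if b = s then a else \<zero>) B = a \<odot>\<^bsub>M\<^esub> s"
proof -
  have "lcomb (\<lambda>b. a) {s} = lcomb (\<lambda>b. if b \<in> {s} then a else \<zero>) B"
    using assms by (intro lcomb_extend) auto
  moreover have "lcomb (\<lambda>b. a) {s} = a \<odot>\<^bsub>M\<^esub> s"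
    unfolding lcomb_def using assms by (auto simp: subset_iff)
  ultimately show ?thesis by simp
qed

text \<open>A relation on a subset extends by zero coefficients to all of \<open>B\<close>, so one
  relation over \<open>B\<close> replaces the quantifier over subsets.\<close>

lemma lin_indep_finite_iff:
  assumes "finite B"
  shows "lin_indep R M B \<longleftrightarrow> B \<subseteq> carrier M \<and>
    (\<forall>c\<in>B \<rightarrow> carrier R. lcomb c B = \<zero>\<^bsub>M\<^esub> \<longrightarrow> (\<forall>b\<in>B. c b = \<zero>))"
proof (intro iffI conjI ballI impI)
  assume B: "B \<subseteq> carrier M \<and> (\<forall>c\<in>B \<rightarrow> carrier R. lcomb c B = \<zero>\<^bsub>M\<^esub> \<longrightarrow> (\<forall>b\<in>B. c b = \<zero>))"
  have "c v = \<zero>" if T: "T \<subseteq> B" "c \<in> T \<rightarrow> carrier R" "lcomb c T = \<zero>\<^bsub>M\<^esub>" "v \<in> T" for T c v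
  proof -
    have "lcomb (\<lambda>b. if b \<in> T then c b else \<zero>) B = \<zero>\<^bsub>M\<^esub>"
      using lcomb_extend[of B T c] assms B T by simp
    moreover have "(\<lambda>b. if b \<in> T then c b else \<zero>) \<in> B \<rightarrow> carrier R" using T by auto
    ultimately have "(if v \<in> T then c v else \<zero>) = \<zero>" using B T by blast
    then show ?thesis using T by simp
  qed
  then show "lin_indep R M B" using B unfolding lin_indep_def lcomb_def by blast
qed (use assms in \<open>auto simp: lin_indep_def lcomb_def\<close>)

lemma lcomb_unique:
  assumes "finite B" "lin_indep R M B" "c \<in> B \<rightarrow> carrier R" "d \<in> B \<rightarrow> carrier R"
    "lcomb c B = lcomb d B" "b \<in> B"
  shows "c b = d b"
proof -
  have B: "B \<subseteq> carrier M" using assms by (simp add: lin_indep_def)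
  have d': "(\<lambda>b. (\<ominus> \<one>) \<otimes> d b) \<in> B \<rightarrow> carrier R" using assms by auto
  have "lcomb (\<lambda>b. c b \<oplus> (\<ominus> \<one>) \<otimes> d b) B = lcomb c B \<oplus>\<^bsub>M\<^esub> (\<ominus> \<one>) \<odot>\<^bsub>M\<^esub> lcomb d B"
    using lcomb_add[OF B assms(3) d'] lcomb_smult[OF assms(1) B assms(4), of "\<ominus> \<one>"] by simp
  also have "\<dots> = \<zero>\<^bsub>M\<^esub>"
    using assms B by (simp add: smult_l_minus M.r_neg)
  finally have "c b \<oplus> (\<ominus> \<one>) \<otimes> d b = \<zero>"
    using assms(1,2,3,6) d' unfolding lin_indep_finite_iff[OF assms(1)]
    by (auto simp: Pi_iff)
  moreover have "c b \<in> carrier R" "d b \<in> carrier R" using assms by auto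
  ultimately show ?thesis by (simp add: l_minus) (metis R.minus_equality R.minus_minus R.add.inv_closed R.a_comm)
qed

definition lspan :: "'m set \<Rightarrow> 'm set" where
  "lspan B = {lcomb c B | c. c \<in> B \<rightarrow> carrier R}"

lemma lspan_add:
  assumes "B \<subseteq> carrier M" "x \<in> lspan B" "y \<in> lspan B" shows "x \<oplus>\<^bsub>M\<^esub> y \<in> lspan B"
proof -
  obtain c d where "c \<in> B \<rightarrow> carrier R" "d \<in> B \<rightarrow> carrier R" "x = lcomb c B" "y = lcomb d B"
    using assms by (auto simp: lspan_def)
  then show ?thesis using assms(1) unfolding lspan_def
    by (auto simp: lcomb_add[symmetric] Pi_iff intro!: exI[of _ "\<lambda>b. c b \<oplus> d b"])
qed

lemma lspan_smult:
  assumes "finite B" "B \<subseteq> carrier M" "x \<in> lspan B" "a \<in> carrier R" shows "a \<odot>\<^bsub>M\<^esub> x \<in> lspan B"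
proof -
  obtain c where "c \<in> B \<rightarrow> carrier R" "x = lcomb c B"
    using assms by (auto simp: lspan_def)
  then show ?thesis using assms unfolding lspan_def
    by (auto simp: lcomb_smult Pi_iff intro!: exI[of _ "\<lambda>b. a \<otimes> c b"])
qed

lemma lspan_zero: "B \<subseteq> carrier M \<Longrightarrow> \<zero>\<^bsub>M\<^esub> \<in> lspan B"
proof -
  assume "B \<subseteq> carrier M"
  then have "lcomb (\<lambda>_. \<zero>) B = finsum M (\<lambda>_. \<zero>\<^bsub>M\<^esub>) B"
    unfolding lcomb_def by (intro M.finsum_cong') (auto simp: subset_iff)
  then have "lcomb (\<lambda>_. \<zero>) B = \<zero>\<^bsub>M\<^esub>" by simp
  then show ?thesis unfolding lspan_def by (auto intro!: exI[of _ "\<lambda>_. \<zero>"])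
qed

lemma lspan_subset: "B \<subseteq> carrier M \<Longrightarrow> lspan B \<subseteq> carrier M"
  unfolding lspan_def by auto

lemma lspan_finsum:
  assumes "B \<subseteq> carrier M" "finite G" "\<And>g. g \<in> G \<Longrightarrow> f g \<in> lspan B"
  shows "finsum M f G \<in> lspan B"
  using assms(2,3)
proof (induct G)
  case empty then show ?case using lspan_zero assms(1) by simp
next
  case (insert g G)
  then have "f \<in> insert g G \<rightarrow> carrier M" using lspan_subset[OF assms(1)] by blast
  then show ?case using insert lspan_add[OF assms(1)] by simp
qed

text \<open>In a nontrivial relation on \<open>insert g B\<close> the coefficient of
  \<open>g\<close> cannot vanish, because \<open>B\<close> is independent; that coefficient is the
  multiplier.\<close>

lemma lspan_multiple_of_dependent:
  assumes "finite B" "lin_indep R M B" "g \<in> carrier M"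
    "g \<in> B \<or> \<not> lin_indep R M (insert g B)" "\<one> \<noteq> \<zero>"
  shows "\<exists>a\<in>carrier R. a \<noteq> \<zero> \<and> a \<odot>\<^bsub>M\<^esub> g \<in> lspan B"
proof (cases "g \<in> B")
  case True
  have B: "B \<subseteq> carrier M" using assms by (simp add: lin_indep_def)
  have "lcomb (\<lambda>b. if b = g then \<one> else \<zero>) B = \<one> \<odot>\<^bsub>M\<^esub> g"
    using True assms(1) B by (intro lcomb_single) auto
  then have "\<one> \<odot>\<^bsub>M\<^esub> g \<in> lspan B" unfolding lspan_def
    by (auto intro!: exI[of _ "\<lambda>b. if b = g then \<one> else \<zero>"])
  then show ?thesis using assms(5) by blast
next
  case False
  have B: "B \<subseteq> carrier M" using assms by (simp add: lin_indep_def)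
  obtain c b where c: "c \<in> insert g B \<rightarrow> carrier R" "lcomb c (insert g B) = \<zero>\<^bsub>M\<^esub>"
      "b \<in> insert g B" "c b \<noteq> \<zero>"
    using False assms(1,3,4) B by (subst (asm) lin_indep_finite_iff) auto
  have cB: "c \<in> B \<rightarrow> carrier R" and cg: "c g \<in> carrier R" using c by auto
  have eq: "c g \<odot>\<^bsub>M\<^esub> g \<oplus>\<^bsub>M\<^esub> lcomb c B = \<zero>\<^bsub>M\<^esub>"
    using c(2) cB cg B False assms(1,3) unfolding lcomb_def
    by (subst (asm) M.finsum_insert) auto
  have "c g \<noteq> \<zero>"
  proof
    assume "c g = \<zero>"
    then have "lcomb c B = \<zero>\<^bsub>M\<^esub>" using eq assms(3) B cB by simp
    then have "\<forall>b\<in>B. c b = \<zero>" using assms(1,2) cB by (simp add: lin_indep_finite_iff)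
    then show False using c \<open>c g = \<zero>\<close> by auto
  qed
  moreover have "c g \<odot>\<^bsub>M\<^esub> g = (\<ominus> \<one>) \<odot>\<^bsub>M\<^esub> lcomb c B"
    using eq B cB cg assms(3) by (simp add: smult_l_minus M.minus_equality[symmetric] M.a_comm M.minus_equality)
  moreover have "\<dots> \<in> lspan B"
    using assms(1) B cB by (intro lspan_smult) (auto simp: lspan_def)
  ultimately show ?thesis using cg by auto
qed

text \<open>Enlarge \<open>S\<close> by generators to a maximal independent set \<open>B\<close>; a common multiplier \<open>a\<close> moves
  the whole module into the span of \<open>B\<close>, and \<open>h x\<close> is the \<open>s\<close>-coordinate of \<open>a x\<close>.\<close>

lemma separating_functional:
  assumes "domain R" "fin_gen R M" "finite S" "lin_indep R M S" "s \<in> S"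
  shows "\<exists>h \<in> carrier M \<rightarrow> carrier R.
    (\<forall>x\<in>carrier M. \<forall>y\<in>carrier M. h (x \<oplus>\<^bsub>M\<^esub> y) = h x \<oplus> h y) \<and>
    (\<forall>a\<in>carrier R. \<forall>x\<in>carrier M. h (a \<odot>\<^bsub>M\<^esub> x) = a \<otimes> h x) \<and>
    h s \<noteq> \<zero> \<and> (\<forall>t\<in>S - {s}. h t = \<zero>)"
proof -
  interpret domain R by fact
  obtain G where G: "finite G" "G \<subseteq> carrier M" "carrier M = lspan G"
    using assms(2) unfolding fin_gen_def lspan_def lcomb_def by auto
  define \<B> where "\<B> = {B. S \<subseteq> B \<and> B \<subseteq> S \<union> G \<and> lin_indep R M B}"
  have "finite \<B>" "\<B> \<noteq> {}"
    using G(1) assms(3,4) by (auto simp: \<B>_def intro: finite_subset[of _ "Pow (S \<union> G)"])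
  then obtain B where B: "S \<subseteq> B" "B \<subseteq> S \<union> G" "lin_indep R M B"
      and max: "\<And>B'. B' \<in> \<B> \<Longrightarrow> B \<subseteq> B' \<Longrightarrow> B = B'"
    using finite_has_maximal[of \<B>] by (auto simp: \<B>_def)
  have finB: "finite B" using B(2) G(1) assms(3) by (auto intro: finite_subset)
  have BM: "B \<subseteq> carrier M" using B(3) by (simp add: lin_indep_def)
  have multiple: "\<exists>a\<in>carrier R. a \<noteq> \<zero> \<and> a \<odot>\<^bsub>M\<^esub> g \<in> lspan B" if "g \<in> G" for g
  proof (rule lspan_multiple_of_dependent[OF finB B(3)])
    show "g \<in> B \<or> \<not> lin_indep R M (insert g B)"
      using max[of "insert g B"] B that by (auto simp: \<B>_def)
  qed (use that G in auto)
  \<comment> \<open>The product of the multipliers of the single generators serves all of them, and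
    is nonzero in a domain.\<close>
  have "\<exists>a\<in>carrier R. a \<noteq> \<zero> \<and> (\<forall>g\<in>G'. a \<odot>\<^bsub>M\<^esub> g \<in> lspan B)" if "G' \<subseteq> G" for G'
    using finite_subset[OF that G(1)] that
  proof (induct G')
    case empty then show ?case by (auto intro!: bexI[of _ \<one>])
  next
    case (insert g G')
    then obtain a b where ab: "a \<in> carrier R" "a \<noteq> \<zero>" "\<forall>g\<in>G'. a \<odot>\<^bsub>M\<^esub> g \<in> lspan B"
      "b \<in> carrier R" "b \<noteq> \<zero>" "b \<odot>\<^bsub>M\<^esub> g \<in> lspan B" using multiple[of g] by auto
    have "(a \<otimes> b) \<odot>\<^bsub>M\<^esub> h \<in> lspan B" if h: "h \<in> insert g G'" for h
    proof (cases "h = g")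
      case True
      then have "(a \<otimes> b) \<odot>\<^bsub>M\<^esub> h = a \<odot>\<^bsub>M\<^esub> (b \<odot>\<^bsub>M\<^esub> g)"
        using ab insert(4) G(2) by (auto simp: smult_assoc1)
      then show ?thesis using ab lspan_smult[OF finB BM] by simp
    next
      case False
      then have "(a \<otimes> b) \<odot>\<^bsub>M\<^esub> h = b \<odot>\<^bsub>M\<^esub> (a \<odot>\<^bsub>M\<^esub> h)"
        using ab h insert(4) G(2) by (subst m_comm) (auto simp: smult_assoc1)
      then show ?thesis using ab h False lspan_smult[OF finB BM] by auto
    qed
    then show ?case using ab integral by (intro bexI[of _ "a \<otimes> b"]) auto
  qed
  then obtain a where a: "a \<in> carrier R" "a \<noteq> \<zero>" "\<forall>g\<in>G. a \<odot>\<^bsub>M\<^esub> g \<in> lspan B" by blast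
  have "a \<odot>\<^bsub>M\<^esub> x \<in> lspan B" if "x \<in> carrier M" for x
  proof -
    obtain c where c: "c \<in> G \<rightarrow> carrier R" "x = lcomb c G" using \<open>x \<in> carrier M\<close> G(3) by (auto simp: lspan_def)
    have "a \<odot>\<^bsub>M\<^esub> x = finsum M (\<lambda>g. a \<odot>\<^bsub>M\<^esub> (c g \<odot>\<^bsub>M\<^esub> g)) G"
      unfolding c(2) lcomb_def using c(1) a(1) G(1,2) by (intro finsum_smult_ldistr) auto
    moreover have "a \<odot>\<^bsub>M\<^esub> (c g \<odot>\<^bsub>M\<^esub> g) \<in> lspan B" if "g \<in> G" for g
    proof -
      have "c g \<in> carrier R" "g \<in> carrier M" using that c(1) G(2) by auto
      then have "a \<odot>\<^bsub>M\<^esub> (c g \<odot>\<^bsub>M\<^esub> g) = c g \<odot>\<^bsub>M\<^esub> (a \<odot>\<^bsub>M\<^esub> g)"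
        using a(1) by (metis m_comm smult_assoc1)
      then show ?thesis using that a(3) c(1) lspan_smult[OF finB BM] by auto
    qed
    ultimately show ?thesis using lspan_finsum[OF BM G(1)] by simp
  qed
  then have "\<forall>x\<in>carrier M. \<exists>c. c \<in> B \<rightarrow> carrier R \<and> a \<odot>\<^bsub>M\<^esub> x = lcomb c B"
    unfolding lspan_def by blast
  then obtain C where C: "\<And>x. x \<in> carrier M \<Longrightarrow> C x \<in> B \<rightarrow> carrier R"
      "\<And>x. x \<in> carrier M \<Longrightarrow> a \<odot>\<^bsub>M\<^esub> x = lcomb (C x) B"
    by metis
  have sB: "s \<in> B" using assms(5) B by auto
  \<comment> \<open>Coordinates over the independent set \<open>B\<close> are unique, so the chosen
    coefficients \<open>C x\<close> inherit additivity and R-linearity in \<open>x\<close>.\<close>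
  have unique: "C x s = d s" if "x \<in> carrier M" "d \<in> B \<rightarrow> carrier R" "a \<odot>\<^bsub>M\<^esub> x = lcomb d B" for x d
    using lcomb_unique[OF finB B(3) C(1)[OF that(1)] that(2) _ sB] C(2) that by simp
  have base: "C t s = (if s = t then a else \<zero>)" if "t \<in> B" for t
    using that BM a(1) lcomb_single[OF finB BM that a(1)]
    by (subst unique[of t "\<lambda>b. if b = t then a else \<zero>"]) auto
  show ?thesis
  proof (intro bexI[of _ "\<lambda>x. C x s"] conjI ballI)
    fix x y assume xy: "x \<in> carrier M" "y \<in> carrier M"
    have "a \<odot>\<^bsub>M\<^esub> (x \<oplus>\<^bsub>M\<^esub> y) = lcomb (\<lambda>b. C x b \<oplus> C y b) B"
      using xy a(1) C by (simp add: smult_r_distr lcomb_add BM)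
    then show "C (x \<oplus>\<^bsub>M\<^esub> y) s = C x s \<oplus> C y s"
      using xy C(1)[OF xy(1)] C(1)[OF xy(2)] by (subst unique) (auto simp: Pi_iff)
  next
    fix e x assume ex: "e \<in> carrier R" "x \<in> carrier M"
    have "a \<odot>\<^bsub>M\<^esub> (e \<odot>\<^bsub>M\<^esub> x) = e \<odot>\<^bsub>M\<^esub> (a \<odot>\<^bsub>M\<^esub> x)"
      using ex a(1) by (metis m_comm smult_assoc1)
    also have "\<dots> = lcomb (\<lambda>b. e \<otimes> C x b) B"
      using ex C by (simp add: lcomb_smult finB BM)
    finally show "C (e \<odot>\<^bsub>M\<^esub> x) s = e \<otimes> C x s"
      using ex C(1)[OF ex(2)] by (subst unique) (auto simp: Pi_iff)
  next
    show "C s s \<noteq> \<zero>" using base[OF sB] a(2) by simp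
  next
    fix t assume "t \<in> S - {s}"
    then show "C t s = \<zero>" using base[of t] B(1) by auto
  next
    show "(\<lambda>x. C x s) \<in> carrier M \<rightarrow> carrier R" using C(1) sB by blast
  qed
qed

end

section \<open>Algebraic sets with coordinate algebra \<open>F\<^sub>r \<oplus> M\<close>\<close>

lemma pvar_power: "pvar i ^ e = Poly_Mapping.single (Poly_Mapping.single i e) 1"
  by (induct e) (simp_all add: pvar_def mult_single single_add[symmetric])

lemma pvar_power_inj: "pvar i ^ d = (pvar i ^ e :: 'k::field kpoly) \<longleftrightarrow> d = e"
proof
  assume "pvar i ^ d = (pvar i ^ e :: 'k kpoly)"
  then have "Poly_Mapping.single i d = Poly_Mapping.single i e"
    unfolding pvar_power by (metis keys_single singleton_inject zero_neq_one)
  then show "d = e" by (metis lookup_single_eq)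
qed simp

lemma pvar_neq_zero [simp]: "pvar i \<noteq> 0"
  unfolding pvar_def by (metis keys_single keys_zero insert_not_empty zero_neq_one)

lemma Fr_eqI:
  assumes "u \<in> Fr r" "v \<in> Fr r" "linpart r u = linpart r v" "\<And>j. fox r u j = fox r v j"
  shows "u = v"
  using Fr_eq_zero_iff[of "u - v" r] assms by auto

text \<open>The complement of \<open>Vset r n S\<close> is the union over \<open>f\<close> in
  \<open>S\<close> of the sets where \<open>f\<close> is nonzero, so finite intersections of sets of
  this kind form a base.\<close>

lemma zariski_open_nbhd:
  assumes "openin (zariski r n) U" "q \<in> U"
  obtains T where "finite T" "T \<subseteq> Fr (r + n)" "\<forall>f\<in>T. eval_at r n f q \<noteq> 0"
    "{p \<in> affine r n. \<forall>f\<in>T. eval_at r n f p \<noteq> 0} \<subseteq> U"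
proof -
  let ?nbhd = "\<lambda>U T. finite T \<and> T \<subseteq> Fr (r + n) \<and> (\<forall>f\<in>T. eval_at r n f q \<noteq> 0) \<and>
    {p \<in> affine r n. \<forall>f\<in>T. eval_at r n f p \<noteq> 0} \<subseteq> U"
  have "generate_topology_on (insert (affine r n) {affine r n - Vset r n S | S. S \<subseteq> Fr (r + n)}) U"
    using assms(1) unfolding zariski_def by (rule openin_topology_generated_by)
  then have "\<exists>T. ?nbhd U T" using assms(2)
  proof induct
    case (Int A B)
    then obtain T T' where "?nbhd A T" "?nbhd B T'" by auto
    then have "?nbhd (A \<inter> B) (T \<union> T')" by blast
    then show ?case by (rule exI)
  next
    case (UN K)
    then obtain A where A: "A \<in> K" "q \<in> A" by blast
    from UN(2)[OF A] obtain T where T: "?nbhd A T" by (rule exE)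
    then have "?nbhd (\<Union>K) T" using Union_upper[OF A(1)] by (meson subset_trans)
    then show ?case by (rule exI)
  next
    case (Basis A)
    then consider "A = affine r n" | S where "S \<subseteq> Fr (r + n)" "A = affine r n - Vset r n S" by blast
    then show ?case
    proof cases
      case 1
      then have "?nbhd A {}" by auto
      then show ?thesis by blast
    next
      case 2
      then obtain f where "f \<in> S" "eval_at r n f q \<noteq> 0"
        using Basis(2) by (auto simp: Vset_def)
      then have "?nbhd A {f}" using 2 by (auto simp: Vset_def)
      then show ?thesis by blast
    qed
  qed simp
  then show ?thesis using that by blast
qed

lemma topspace_zariski: "topspace (zariski r n) = affine r n"
  unfolding zariski_def by auto

locale coord_algebra =
  fixes r n :: nat and Y :: "'k::field fml list set" and M :: "('k kpoly, 'm) module"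
    and \<psi> :: "'k fml set \<Rightarrow> 'k fml \<times> 'm"
  assumes r2: "2 \<le> r"
    and algebraic: "algebraic_set r n Y"
    and module_M: "module (Rring r) M"
    and bij: "bij_betw \<psi> (Gamma r n Y) (Fr r \<times> carrier M)"
    and \<psi>_hom: "\<And>f g. f \<in> Fr (r + n) \<Longrightarrow> g \<in> Fr (r + n) \<Longrightarrow>
        \<psi> (coset r n Y (fadd f g)) = sd_add M (\<psi> (coset r n Y f)) (\<psi> (coset r n Y g)) \<and>
        \<psi> (coset r n Y (fbr f g)) = sd_br r M (\<psi> (coset r n Y f)) (\<psi> (coset r n Y g))"
    and \<psi>_smult: "\<And>c f. f \<in> Fr (r + n) \<Longrightarrow>
        \<psi> (coset r n Y (fsmult c f)) = sd_smult M c (\<psi> (coset r n Y f))"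
    and \<psi>_Fr: "\<And>u. u \<in> Fr r \<Longrightarrow> \<psi> (coset r n Y u) = (u, \<zero>\<^bsub>M\<^esub>)"
begin

interpretation M: plain_module "Rring r" M
  unfolding plain_module_def by (rule module_M)

abbreviation \<pi> where "\<pi> f \<equiv> \<psi> (coset r n Y f)"
abbreviation ev where "ev f p \<equiv> eval_at r n f p"

section \<open>Functions on \<open>Y\<close> and their constant and module parts\<close>

lemma Fr_r [intro]: "u \<in> Fr r \<Longrightarrow> u \<in> Fr (r + n)"
  using Fr_mono[of r "r + n"] by auto

lemma Y_affine: "Y \<subseteq> affine r n"
  using algebraic by (auto simp: algebraic_set_def Vset_def)

lemma ev_Fr: "f \<in> Fr (r + n) \<Longrightarrow> p \<in> Y \<Longrightarrow> ev f p \<in> Fr r"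
  using Y_affine by (blast intro: eval_in_Fr)

lemma Rad_iff: "f \<in> Rad r n Y \<longleftrightarrow> f \<in> Fr (r + n) \<and> (\<forall>p\<in>Y. ev f p = 0)"
  by (auto simp: Rad_def)

lemma coset_iff: "g \<in> coset r n Y f \<longleftrightarrow> g \<in> Fr (r + n) \<and> g - f \<in> Rad r n Y"
  by (simp add: coset_def minus_fml_def)

text \<open>Cosets of the radical coincide exactly for polynomials that agree as functions on
  \<open>Y\<close>, and \<open>\<psi>\<close> is injective on cosets.\<close>

lemma \<pi>_eq_iff:
  assumes "f \<in> Fr (r + n)" "g \<in> Fr (r + n)"
  shows "\<pi> f = \<pi> g \<longleftrightarrow> (\<forall>p\<in>Y. ev f p = ev g p)"
proof -
  have "\<pi> f = \<pi> g \<longleftrightarrow> coset r n Y f = coset r n Y g"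
    using bij assms unfolding bij_betw_def Gamma_def by (auto dest: inj_onD)
  also have "\<dots> \<longleftrightarrow> (\<forall>p\<in>Y. ev f p = ev g p)"
  proof
    assume "coset r n Y f = coset r n Y g"
    moreover have "f \<in> coset r n Y f" using assms by (simp add: coset_iff Rad_iff)
    ultimately show "\<forall>p\<in>Y. ev f p = ev g p" by (auto simp: coset_iff Rad_iff)
  next
    assume "\<forall>p\<in>Y. ev f p = ev g p"
    then show "coset r n Y f = coset r n Y g"
      using assms by (auto simp: set_eq_iff coset_iff Rad_iff)
  qed
  finally show ?thesis .
qed

lemma \<pi>_mem: "f \<in> Fr (r + n) \<Longrightarrow> \<pi> f \<in> Fr r \<times> carrier M"
  using bij unfolding bij_betw_def Gamma_def by auto

lemma \<pi>_closed [simp]: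
  "f \<in> Fr (r + n) \<Longrightarrow> fst (\<pi> f) \<in> Fr r" "f \<in> Fr (r + n) \<Longrightarrow> snd (\<pi> f) \<in> carrier M"
  using \<pi>_mem[of f] by (auto simp: mem_Times_iff)

lemma \<pi>_surj: "u \<in> Fr r \<Longrightarrow> x \<in> carrier M \<Longrightarrow> \<exists>f\<in>Fr (r + n). \<pi> f = (u, x)"
proof -
  assume "u \<in> Fr r" "x \<in> carrier M"
  then have "(u, x) \<in> \<psi> ` coset r n Y ` Fr (r + n)"
    using bij unfolding bij_betw_def Gamma_def by auto
  then show ?thesis by auto
qed

lemma \<pi>_add: "f \<in> Fr (r + n) \<Longrightarrow> g \<in> Fr (r + n) \<Longrightarrow>
    \<pi> (f + g) = (fst (\<pi> f) + fst (\<pi> g), snd (\<pi> f) \<oplus>\<^bsub>M\<^esub> snd (\<pi> g))"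
  and \<pi>_br: "f \<in> Fr (r + n) \<Longrightarrow> g \<in> Fr (r + n) \<Longrightarrow>
    \<pi> (fbr f g) = (fbr (fst (\<pi> f)) (fst (\<pi> g)),
      linpart r (fst (\<pi> g)) \<odot>\<^bsub>M\<^esub> snd (\<pi> f) \<oplus>\<^bsub>M\<^esub> (- linpart r (fst (\<pi> f))) \<odot>\<^bsub>M\<^esub> snd (\<pi> g))"
  and \<pi>_smult: "f \<in> Fr (r + n) \<Longrightarrow> \<pi> (fsmult c f) = (fsmult c (fst (\<pi> f)), kconst c \<odot>\<^bsub>M\<^esub> snd (\<pi> f))"
  using \<psi>_hom[of f g] \<psi>_smult[of f c] by (simp_all add: sd_add_def sd_br_def sd_smult_def)

text \<open>A polynomial representing the module element \<open>x\<close>; by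
  \<open>ev_eq_lift\<close> its values on \<open>Y\<close> do not depend on the choice.\<close>

definition lift :: "'m \<Rightarrow> 'k fml" where
  "lift x = (SOME f. f \<in> Fr (r + n) \<and> \<pi> f = (0, x))"

lemma lift: "x \<in> carrier M \<Longrightarrow> lift x \<in> Fr (r + n)" "x \<in> carrier M \<Longrightarrow> \<pi> (lift x) = (0, x)"
  using someI_ex[of "\<lambda>f. f \<in> Fr (r + n) \<and> \<pi> f = (0, x)"] \<pi>_surj[of 0 x]
  unfolding lift_def[symmetric] by auto

lemma ev_eq_lift:
  assumes "f \<in> Fr (r + n)" "\<pi> f = (0, x)" "p \<in> Y"
  shows "ev f p = ev (lift x) p"
proof -
  have "x \<in> carrier M" using \<pi>_closed(2)[OF assms(1)] assms(2) by simp
  then show ?thesis using \<pi>_eq_iff[OF assms(1) lift(1)] lift(2) assms by auto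
qed

lemma ev_decomp:
  assumes "f \<in> Fr (r + n)" "p \<in> Y"
  shows "ev f p = fst (\<pi> f) + ev (lift (snd (\<pi> f))) p"
proof -
  let ?h = "fst (\<pi> f) + lift (snd (\<pi> f))"
  have h: "?h \<in> Fr (r + n)" using assms lift(1) \<pi>_closed by (intro Fr_add[OF Fr_r lift(1)]) auto
  have "\<pi> ?h = \<pi> f"
    using assms lift[of "snd (\<pi> f)"] by (subst \<pi>_add) (auto simp: \<psi>_Fr)
  then have "ev ?h p = ev f p" using \<pi>_eq_iff[OF h assms(1)] assms(2) by auto
  then show ?thesis using assms(1) by simp
qed

lemma ev_lift_add:
  assumes "x \<in> carrier M" "y \<in> carrier M" "p \<in> Y"
  shows "ev (lift (x \<oplus>\<^bsub>M\<^esub> y)) p = ev (lift x) p + ev (lift y) p"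
  using ev_eq_lift[of "lift x + lift y" "x \<oplus>\<^bsub>M\<^esub> y" p] assms lift Fr_add[OF lift(1) lift(1)]
  by (simp add: \<pi>_add)

lemma ev_lift_zero: "p \<in> Y \<Longrightarrow> ev (lift \<zero>\<^bsub>M\<^esub>) p = 0"
  using ev_eq_lift[of 0 "\<zero>\<^bsub>M\<^esub>" p] \<psi>_Fr[of 0] by auto

lemma ev_lift_br:
  assumes "x \<in> carrier M" "v \<in> Fr r" "p \<in> Y"
  shows "ev (lift (linpart r v \<odot>\<^bsub>M\<^esub> x)) p = fbr (ev (lift x) p) v"
proof -
  have "\<pi> (fbr (lift x) v) = (0, linpart r v \<odot>\<^bsub>M\<^esub> x)"
    using assms lift by (subst \<pi>_br) (auto simp: \<psi>_Fr)
  moreover have "fbr (lift x) v \<in> Fr (r + n)" using assms lift by auto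
  ultimately show ?thesis using ev_eq_lift[of "fbr (lift x) v"] assms by simp
qed

text \<open>The commutator \<open>?v\<close> has linear part 0 and so annihilates \<open>x\<close>.
  Coordinate 0 of the bracket of the value with \<open>?v\<close> is, up to sign, its linear part
  times \<open>pvar 1\<close>, and polynomials have no zero divisors.\<close>

lemma ev_lift_DF:
  assumes "x \<in> carrier M" "p \<in> Y" shows "ev (lift x) p \<in> DF r"
proof (rule Fr_linpart_zero)
  show "ev (lift x) p \<in> Fr r" using assms lift ev_Fr by auto
  let ?v = "fbr (gen 0) (gen 1) :: 'k fml"
  have "?v \<in> Fr r" using r2 by (intro Fr_br Fr_gen) auto
  then have "fbr (ev (lift x) p) ?v = 0"
    using ev_lift_br[of x ?v p] assms ev_lift_zero M.smult_l_null[of x] by simp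
  then have "fox r (fbr (ev (lift x) p) ?v) 0 = 0" by simp
  then show "linpart r (ev (lift x) p) = 0" using r2 by (simp add: fox_simps(4)[of r _ ?v] del: One_nat_def)
qed

text \<open>A variable acts on the module as a bracket with a generator, which evaluation preserves;
  the value lies in \<open>DF r\<close>, where this bracket multiplies coordinates by the
  variable.\<close>

lemma fox_ev_lift_smult:
  assumes "a \<in> carrier (Rring r)" "x \<in> carrier M" "p \<in> Y"
  shows "fox r (ev (lift (a \<odot>\<^bsub>M\<^esub> x)) p) j = a * fox r (ev (lift x) p) j"
  using assms(1)
proof (induct rule: Rring_induct)
  case (const c)
  have "\<pi> (fsmult c (lift x)) = (0, kconst c \<odot>\<^bsub>M\<^esub> x)" "fsmult c (lift x) \<in> Fr (r + n)"
    using assms lift by (auto simp: \<pi>_smult fsmult_simps)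
  then have "ev (lift (kconst c \<odot>\<^bsub>M\<^esub> x)) p = fsmult c (ev (lift x) p)"
    using ev_eq_lift[of "fsmult c (lift x)"] assms by auto
  then show ?case by simp
next
  case (var i a)
  have "(pvar i * a) \<odot>\<^bsub>M\<^esub> x = linpart r (gen i) \<odot>\<^bsub>M\<^esub> (a \<odot>\<^bsub>M\<^esub> x)"
    using M.smult_assoc1[of "pvar i" a x] var assms by simp
  then have "ev (lift ((pvar i * a) \<odot>\<^bsub>M\<^esub> x)) p = fbr (ev (lift (a \<odot>\<^bsub>M\<^esub> x)) p) (gen i)"
    using ev_lift_br[of "a \<odot>\<^bsub>M\<^esub> x" "gen i" p] var assms by auto
  moreover have "linpart r (ev (lift (a \<odot>\<^bsub>M\<^esub> x)) p) = 0"
    using ev_lift_DF[of "a \<odot>\<^bsub>M\<^esub> x" p] var assms by simp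
  ultimately show ?case using var by simp
next
  case (add a b)
  have "(a + b) \<odot>\<^bsub>M\<^esub> x = a \<odot>\<^bsub>M\<^esub> x \<oplus>\<^bsub>M\<^esub> b \<odot>\<^bsub>M\<^esub> x"
    using M.smult_l_distr[of a b x] add assms by simp
  then show ?case using add assms by (simp add: ev_lift_add algebra_simps)
qed

lemma fox_ev_lift_finsum:
  assumes "finite T" "T \<subseteq> carrier M" "c \<in> T \<rightarrow> carrier (Rring r)" "p \<in> Y"
  shows "fox r (ev (lift (finsum M (\<lambda>v. c v \<odot>\<^bsub>M\<^esub> v) T)) p) j = (\<Sum>v\<in>T. c v * fox r (ev (lift v) p) j)"
  using assms(1-3)
proof (induct T)
  case empty then show ?case using assms(4) by (simp add: ev_lift_zero)
next
  case (insert v T)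
  then have "(\<lambda>v. c v \<odot>\<^bsub>M\<^esub> v) \<in> T \<rightarrow> carrier M" "c v \<odot>\<^bsub>M\<^esub> v \<in> carrier M" by auto
  then show ?case using insert assms(4) by (simp add: ev_lift_add fox_ev_lift_smult)
qed

text \<open>Points of \<open>Y\<close> are homomorphisms from the module to the derived algebra; here \<open>h\<close> is such a
  homomorphism, followed by the Magnus embedding.\<close>

lemma point_exists:
  fixes h :: "'m \<Rightarrow> nat \<Rightarrow> 'k kpoly"
  assumes DF: "\<And>x. x \<in> carrier M \<Longrightarrow> \<exists>w\<in>DF r. \<forall>j. fox r w j = h x j"
    and add: "\<And>x y j. x \<in> carrier M \<Longrightarrow> y \<in> carrier M \<Longrightarrow> h (x \<oplus>\<^bsub>M\<^esub> y) j = h x j + h y j"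
    and smult: "\<And>a x j. a \<in> carrier (Rring r) \<Longrightarrow> x \<in> carrier M \<Longrightarrow> h (a \<odot>\<^bsub>M\<^esub> x) j = a * h x j"
  obtains p where "p \<in> Y"
    "\<And>f. f \<in> Fr (r + n) \<Longrightarrow> linpart r (ev f p) = linpart r (fst (\<pi> f))"
    "\<And>f j. f \<in> Fr (r + n) \<Longrightarrow> fox r (ev f p) j = fox r (fst (\<pi> f)) j + h (snd (\<pi> f)) j"
proof -
  obtain \<kappa> where \<kappa>: "\<And>x. x \<in> carrier M \<Longrightarrow> \<kappa> x \<in> DF r"
      "\<And>x j. x \<in> carrier M \<Longrightarrow> fox r (\<kappa> x) j = h x j"
  proof -
    have "\<forall>x\<in>carrier M. \<exists>w. w \<in> DF r \<and> (\<forall>j. fox r w j = h x j)" using DF by blast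
    from bchoice[OF this] show ?thesis using that by blast
  qed
  have \<kappa>Fr: "\<kappa> x \<in> Fr r" if "x \<in> carrier M" for x
    using \<kappa>(1)[OF that] DF_subset_Fr by auto
  have h0: "h \<zero>\<^bsub>M\<^esub> j = 0" for j
    using smult[of 0 "\<zero>\<^bsub>M\<^esub>" j] M.smult_l_null[of "\<zero>\<^bsub>M\<^esub>"] by simp
  \<comment> \<open>The homomorphism from the semidirect product belonging to \<open>h\<close>,
    composed with \<open>\<pi>\<close>; the point \<open>p\<close> consists of its values at the
    variables. Although \<open>\<kappa>\<close> comes from choice, \<open>\<tau>\<close> respects
    the operations because elements of \<open>Fr r\<close> are determined by their
    coordinates.\<close>
  define \<tau> where "\<tau> f = fst (\<pi> f) + \<kappa> (snd (\<pi> f))" for f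
  have \<tau>Fr: "\<tau> f \<in> Fr r" if "f \<in> Fr (r + n)" for f
    using that \<kappa>Fr by (auto simp: \<tau>_def)
  have lin: "linpart r (\<tau> f) = linpart r (fst (\<pi> f))" if "f \<in> Fr (r + n)" for f
    using that \<kappa>(1) by (simp add: \<tau>_def)
  have fox: "fox r (\<tau> f) j = fox r (fst (\<pi> f)) j + h (snd (\<pi> f)) j" if "f \<in> Fr (r + n)" for f j
    using that \<kappa>(2) by (simp add: \<tau>_def)
  have \<tau>r: "\<tau> u = u" if "u \<in> Fr r" for u
  proof (rule Fr_eqI)
    show "\<tau> u \<in> Fr r" "u \<in> Fr r" using \<tau>Fr that by auto
    show "linpart r (\<tau> u) = linpart r u" "fox r (\<tau> u) j = fox r u j" for j
      using lin[of u] fox[of u] that by (auto simp: \<psi>_Fr h0)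
  qed
  define p where "p = map (\<lambda>j. \<tau> (gen (r + j))) [0..<n]"
  have ev: "ev f p = \<tau> f" if "f \<in> Fr (r + n)" for f
    using that
  proof (induct rule: Fr_induct)
    case zero then show ?case using \<tau>r[of 0] by simp
  next
    case (gen i)
    show ?case
    proof (cases "i < r")
      case True then show ?thesis using \<tau>r[OF Fr_gen[OF True]] by (simp add: eval_gen)
    next
      case False
      then have "i - r < n" using gen by simp
      then show ?thesis using False gen by (simp add: eval_gen p_def)
    qed
  next
    case (add f g)
    have "\<tau> f + \<tau> g = \<tau> (f + g)"
      by (rule Fr_eqI[of _ r])
         (use add in \<open>auto simp: lin fox Fr_add \<pi>_add assms(2) intro: \<tau>Fr\<close>)
    then show ?case using add by simp
  next
    case (smult f c)
    have "fsmult c (\<tau> f) = \<tau> (fsmult c f)"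
    proof (rule Fr_eqI)
      show "fsmult c (\<tau> f) \<in> Fr r" "\<tau> (fsmult c f) \<in> Fr r"
        using smult by (auto intro: \<tau>Fr Fr_smult)
      show "linpart r (fsmult c (\<tau> f)) = linpart r (\<tau> (fsmult c f))"
        using smult by (simp add: lin Fr_smult \<pi>_smult)
      show "fox r (fsmult c (\<tau> f)) j = fox r (\<tau> (fsmult c f)) j" for j
        using smult by (simp add: fox Fr_smult \<pi>_smult assms(3) distrib_left)
    qed
    then show ?case using smult by simp
  next
    case (br f g)
    have "fbr (\<tau> f) (\<tau> g) = \<tau> (fbr f g)"
    proof (rule Fr_eqI)
      show "fbr (\<tau> f) (\<tau> g) \<in> Fr r" "\<tau> (fbr f g) \<in> Fr r"
        using br by (auto intro: \<tau>Fr Fr_br)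
      show "linpart r (fbr (\<tau> f) (\<tau> g)) = linpart r (\<tau> (fbr f g))"
        using br by (simp add: lin Fr_br \<pi>_br)
      show "fox r (fbr (\<tau> f) (\<tau> g)) j = fox r (\<tau> (fbr f g)) j" for j
        using br by (simp add: lin fox Fr_br \<pi>_br assms(2,3) algebra_simps)
    qed
    then show ?case using br by simp
  qed
  have "p \<in> affine r n"
    by (auto simp: affine_def p_def intro!: \<tau>Fr Fr_gen)
  moreover obtain S where S: "S \<subseteq> Fr (r + n)" "Y = Vset r n S"
    using algebraic by (auto simp: algebraic_set_def)
  \<comment> \<open>An equation of \<open>Y\<close> has the same class as 0, so
    \<open>\<tau>\<close> kills it; thus \<open>p\<close> satisfies all equations of
    \<open>Y\<close>.\<close>
  moreover have "ev f p = 0" if "f \<in> S" for f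
  proof -
    have f: "f \<in> Fr (r + n)" using that S by auto
    have "\<pi> f = \<pi> 0" using that S(2) by (subst \<pi>_eq_iff[OF f]) (auto simp: Vset_def)
    then have "\<tau> f = \<tau> 0" by (simp add: \<tau>_def)
    then show ?thesis using ev[OF f] \<tau>r[of 0] by simp
  qed
  ultimately have "p \<in> Y" by (simp add: Vset_def)
  then show ?thesis by (rule that) (simp_all add: ev lin fox)
qed

text \<open>Values at points of \<open>Y\<close> differ from the constant part of \<open>f\<close>
  by elements of \<open>DF r\<close>; whether \<open>f\<close> vanishes at a point is therefore
  decided by \<open>fox\<close> once this linear part is 0.\<close>

lemma linpart_ev:
  assumes "f \<in> Fr (r + n)" "p \<in> Y"
  shows "linpart r (ev f p) = linpart r (fst (\<pi> f))"
  using assms ev_decomp ev_lift_DF by simp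

text \<open>Homomorphisms into the derived algebra form an R-module, so \<open>p + a (q - p)\<close>
  is again a point; the constant part of \<open>f\<close> cancels in the difference.\<close>

lemma line_through:
  assumes "p \<in> Y" "q \<in> Y" "a \<in> carrier (Rring r)"
  obtains s where "s \<in> Y" "\<And>f j. f \<in> Fr (r + n) \<Longrightarrow>
    fox r (ev f s) j = fox r (ev f p) j + a * (fox r (ev f q) j - fox r (ev f p) j)"
proof -
  define h where "h x j = fox r (ev (lift x) p) j +
    a * (fox r (ev (lift x) q) j - fox r (ev (lift x) p) j)" for x j
  obtain s where s: "s \<in> Y"
    "\<And>f j. f \<in> Fr (r + n) \<Longrightarrow> fox r (ev f s) j = fox r (fst (\<pi> f)) j + h (snd (\<pi> f)) j"
  proof (rule point_exists[of h])
    fix x assume x: "x \<in> carrier M"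
    obtain w where w: "w \<in> DF r" "\<And>j. fox r w j = a * fox r (ev (lift x) q - ev (lift x) p) j"
      using DF_fox_scale[OF assms(3) DF_diff[OF ev_lift_DF ev_lift_DF]] x assms by metis
    show "\<exists>w\<in>DF r. \<forall>j. fox r w j = h x j"
      using w ev_lift_DF[OF x assms(1)]
      by (intro bexI[of _ "ev (lift x) p + w"]) (auto simp: h_def intro: DF.add)
  next
    fix x y j assume "x \<in> carrier M" "y \<in> carrier M"
    then show "h (x \<oplus>\<^bsub>M\<^esub> y) j = h x j + h y j"
      using assms by (simp add: h_def ev_lift_add algebra_simps)
  next
    fix b :: "'k kpoly" and x j assume "b \<in> carrier (Rring r)" "x \<in> carrier M"
    then show "h (b \<odot>\<^bsub>M\<^esub> x) j = b * h x j"
      using assms by (simp add: h_def fox_ev_lift_smult algebra_simps)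
  qed auto
  show ?thesis
  proof (rule that[OF s(1)])
    fix f :: "'k fml" and j assume f: "f \<in> Fr (r + n)"
    show "fox r (ev f s) j = fox r (ev f p) j + a * (fox r (ev f q) j - fox r (ev f p) j)"
      using s(2)[OF f, of j] ev_decomp[OF f assms(1)] ev_decomp[OF f assms(2)] by (simp add: h_def)
  qed
qed

section \<open>Irreducibility of the algebraic subsets of \<open>Y\<close>\<close>

lemma ev_eq_zero_iff:
  "f \<in> Fr (r + n) \<Longrightarrow> p \<in> Y \<Longrightarrow> ev f p = 0 \<longleftrightarrow> linpart r (fst (\<pi> f)) = 0 \<and> (\<forall>j. fox r (ev f p) j = 0)"
  using Fr_eq_zero_iff[OF ev_Fr] linpart_ev by simp

text \<open>The point is sought on the curve \<open>s e = p + x\<^sub>0\<^sup>e (q - p)\<close> inside \<open>Z\<close>, where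
  \<open>p\<close> serves the old functions and \<open>q\<close> the new one; each function vanishes for at most one
  exponent.\<close>

lemma common_nonzero:
  assumes S: "S \<subseteq> Fr (r + n)" and Z: "Z = Vset r n S" "Z \<subseteq> Y" "Z \<noteq> {}"
    and T: "finite T" "T \<subseteq> Fr (r + n)" "\<forall>f\<in>T. \<exists>q\<in>Z. ev f q \<noteq> 0"
  shows "\<exists>p\<in>Z. \<forall>f\<in>T. ev f p \<noteq> 0"
  using T
proof (induct T)
  case empty then show ?case using Z by auto
next
  case (insert f T)
  then obtain p where p: "p \<in> Z" "\<forall>g\<in>T. ev g p \<noteq> 0" by auto
  show ?case
  proof (cases "ev f p = 0")
    case False then show ?thesis using p by auto
  next
    case True
    obtain q where q: "q \<in> Z" "ev f q \<noteq> 0" using insert by auto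
    have pq: "p \<in> Y" "q \<in> Y" using p q Z by auto
    let ?a = "\<lambda>e. pvar 0 ^ e :: 'k kpoly"
    have "\<exists>s\<in>Y. \<forall>g\<in>Fr (r + n). \<forall>j.
      fox r (ev g s) j = fox r (ev g p) j + ?a e * (fox r (ev g q) j - fox r (ev g p) j)" for e
      using line_through[OF pq, of "?a e"] r2 by (metis Rring_power Rring_pvar gr0I not_numeral_le_zero)
    then obtain s where s: "\<And>e. s e \<in> Y" "\<And>e g j. g \<in> Fr (r + n) \<Longrightarrow>
      fox r (ev g (s e)) j = fox r (ev g p) j + ?a e * (fox r (ev g q) j - fox r (ev g p) j)"
      by metis
    \<comment> \<open>The coordinates are affine along the curve, so an equation that holds at both
      \<open>p\<close> and \<open>q\<close> holds at every \<open>s e\<close>.\<close>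
    have sZ: "s e \<in> Z" for e
    proof -
      have "ev g (s e) = 0" if "g \<in> S" for g
      proof -
        have g: "g \<in> Fr (r + n)" using that S by auto
        have "ev g p = 0" "ev g q = 0" using p q Z(1) that by (auto simp: Vset_def)
        then show ?thesis using s(1)[of e] s(2)[OF g, of e] g pq by (simp add: ev_eq_zero_iff)
      qed
      then show ?thesis using s(1)[of e] Y_affine Z(1) by (auto simp: Vset_def)
    qed
    have "finite {e. ev g (s e) = 0}" if g: "g \<in> insert f T" for g
    proof -
      have gF: "g \<in> Fr (r + n)" using g insert by auto
      \<comment> \<open>Zeros at two different parameters make the affine coordinates of
        \<open>g\<close> vanish identically, hence \<open>g\<close> at both \<open>p\<close> and
        \<open>q\<close>; but members of \<open>T\<close> are nonzero at \<open>p\<close>, and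
        \<open>f\<close> at \<open>q\<close>.\<close>
      have "d = e" if de: "ev g (s d) = 0" "ev g (s e) = 0" for d e
      proof (rule ccontr)
        assume "d \<noteq> e"
        then have a: "?a d \<noteq> ?a e" by (simp add: pvar_power_inj)
        have eq: "fox r (ev g q) j = fox r (ev g p) j" for j
        proof -
          have "fox r (ev g p) j + ?a d * (fox r (ev g q) j - fox r (ev g p) j)
              = fox r (ev g p) j + ?a e * (fox r (ev g q) j - fox r (ev g p) j)"
            by (simp only: s(2)[OF gF, symmetric] de)
          then show ?thesis using a by simp
        qed
        then have "fox r (ev g p) j = 0" for j using s(2)[OF gF, of d j] de by simp
        moreover have "linpart r (fst (\<pi> g)) = 0" using de gF s(1) by (simp add: ev_eq_zero_iff)
        ultimately have "ev g p = 0" "ev g q = 0" using gF pq eq by (simp_all add: ev_eq_zero_iff)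
        then show False using p q g by auto
      qed
      then obtain e0 where "{e. ev g (s e) = 0} \<subseteq> {e0}" by blast
      then show ?thesis by (rule finite_subset) simp
    qed
    then have "finite (\<Union>g\<in>insert f T. {e. ev g (s e) = 0})" using insert by blast
    then obtain e where "e \<notin> (\<Union>g\<in>insert f T. {e. ev g (s e) = 0})"
      by (metis ex_new_if_finite infinite_UNIV_nat)
    then show ?thesis using sZ[of e] by auto
  qed
qed

text \<open>Each proper closed subset is avoided wherever finitely many functions, none of them zero
  on all of \<open>Z\<close>, are nonzero. \<open>common_nonzero\<close> meets the conditions for
  both subsets at one point.\<close>

lemma irreducible:
  assumes "algebraic_set r n Z" "Z \<subseteq> Y" "Z \<noteq> {}" shows "z_irreducible r n Z"
  unfolding z_irreducible_def
proof (intro conjI)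
  show "Z \<noteq> {}" by fact
  show "Z \<subseteq> affine r n" using assms Y_affine by auto
  show "\<not> (\<exists>Y1 Y2. closedin (subtopology (zariski r n) Z) Y1 \<and>
     closedin (subtopology (zariski r n) Z) Y2 \<and> Y1 \<subset> Z \<and> Y2 \<subset> Z \<and> Z = Y1 \<union> Y2)"
  proof
    assume "\<exists>Y1 Y2. closedin (subtopology (zariski r n) Z) Y1 \<and>
       closedin (subtopology (zariski r n) Z) Y2 \<and> Y1 \<subset> Z \<and> Y2 \<subset> Z \<and> Z = Y1 \<union> Y2"
    then obtain Y1 Y2 where Y12: "closedin (subtopology (zariski r n) Z) Y1"
       "closedin (subtopology (zariski r n) Z) Y2" "Y1 \<subset> Z" "Y2 \<subset> Z" "Z = Y1 \<union> Y2" by blast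
    obtain S where S: "S \<subseteq> Fr (r + n)" "Z = Vset r n S" using assms by (auto simp: algebraic_set_def)
    have *: "\<exists>T. finite T \<and> T \<subseteq> Fr (r + n) \<and> (\<forall>f\<in>T. \<exists>q\<in>Z. ev f q \<noteq> 0) \<and>
        (\<forall>p\<in>Z. (\<forall>f\<in>T. ev f p \<noteq> 0) \<longrightarrow> p \<notin> W)"
      if W: "closedin (subtopology (zariski r n) Z) W" "W \<subset> Z" for W
    proof -
      obtain C where C: "closedin (zariski r n) C" "W = C \<inter> Z"
        using W(1) by (auto simp: closedin_subtopology)
      obtain q where q: "q \<in> Z" "q \<notin> W" using W(2) by auto
      have q': "q \<in> topspace (zariski r n) - C"
        using q C(2) assms(2) Y_affine by (auto simp: topspace_zariski)
      have o: "openin (zariski r n) (topspace (zariski r n) - C)" using C(1) by auto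
      obtain T where T: "finite T" "T \<subseteq> Fr (r + n)" "\<forall>f\<in>T. ev f q \<noteq> 0"
        "{p \<in> affine r n. \<forall>f\<in>T. ev f p \<noteq> 0} \<subseteq> topspace (zariski r n) - C"
        by (rule zariski_open_nbhd[OF o q'])
      have "p \<notin> W" if "p \<in> Z" "\<forall>f\<in>T. ev f p \<noteq> 0" for p
      proof -
        have "p \<in> affine r n" using that(1) assms(2) Y_affine by auto
        then have "p \<in> topspace (zariski r n) - C" using that(2) T(4) by (auto dest: subsetD)
        then show ?thesis using C(2) by simp
      qed
      then show ?thesis using T(1,2,3) q(1) by (intro exI[of _ T]) auto
    qed
    obtain T1 T2 where T: "finite T1" "T1 \<subseteq> Fr (r + n)" "\<forall>f\<in>T1. \<exists>q\<in>Z. ev f q \<noteq> 0"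
        "\<forall>p\<in>Z. (\<forall>f\<in>T1. ev f p \<noteq> 0) \<longrightarrow> p \<notin> Y1"
        "finite T2" "T2 \<subseteq> Fr (r + n)" "\<forall>f\<in>T2. \<exists>q\<in>Z. ev f q \<noteq> 0"
        "\<forall>p\<in>Z. (\<forall>f\<in>T2. ev f p \<noteq> 0) \<longrightarrow> p \<notin> Y2"
      using *[OF Y12(1,3)] *[OF Y12(2,4)] by blast
    obtain p where "p \<in> Z" "\<forall>f\<in>T1 \<union> T2. ev f p \<noteq> 0"
      using common_nonzero[OF S assms(2,3), of "T1 \<union> T2"] T by blast
    then show False using T(4,8) Y12(5) by blast
  qed
qed

text \<open>An equation \<open>f i\<close> separating \<open>c i\<close> from \<open>c (i + 1)\<close> has a module part \<open>v i\<close>; the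
  homomorphisms \<open>\<delta> i\<close> are triangular with respect to the \<open>v l\<close>, which forces independence.\<close>

lemma independent_of_chain:
  assumes c: "c 0 = Y" "\<And>i. i \<le> m \<Longrightarrow> algebraic_set r n (c i)" "c m \<noteq> {}"
    "\<And>i. i < m \<Longrightarrow> c (Suc i) \<subset> c i"
  shows "\<exists>S. lin_indep (Rring r) M S \<and> card S = m"
proof -
  have anti: "c j \<subseteq> c i" if "i \<le> j" "j \<le> m" for i j
    using that
  proof (induct j rule: dec_induct)
    case (step l)
    then have "c l \<subseteq> c i" "c (Suc l) \<subset> c l" using c(4) by simp_all
    then show ?case by (meson order.trans psubset_imp_subset)
  qed simp
  have cY: "c i \<subseteq> Y" if "i \<le> m" for i using anti[of 0 i] c(1) that by simp
  have "\<exists>fq. snd fq \<in> c i \<and> fst fq \<in> Fr (r + n) \<and> ev (fst fq) (snd fq) \<noteq> 0 \<and>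
      (\<forall>p\<in>c (Suc i). ev (fst fq) p = 0)" if i: "i < m" for i
  proof -
    obtain S where S: "S \<subseteq> Fr (r + n)" "c (Suc i) = Vset r n S"
      using c(2)[of "Suc i"] i by (auto simp: algebraic_set_def)
    obtain q where q: "q \<in> c i" "q \<notin> c (Suc i)" using c(4)[OF i] by auto
    then have "q \<in> affine r n" using cY[of i] i Y_affine by auto
    then obtain f where "f \<in> S" "ev f q \<noteq> 0" using S(2) q(2) by (auto simp: Vset_def)
    moreover have "\<forall>p\<in>c (Suc i). ev f p = 0" using S(2) \<open>f \<in> S\<close> by (auto simp: Vset_def)
    ultimately show ?thesis using S(1) q(1) \<open>f \<in> S\<close> \<open>ev f q \<noteq> 0\<close>
      by (intro exI[of _ "(f, q)"]) auto
  qed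
  note choose = this
  obtain f q where fq: "\<And>i. i < m \<Longrightarrow> q i \<in> c i" "\<And>i. i < m \<Longrightarrow> f i \<in> Fr (r + n)"
      "\<And>i. i < m \<Longrightarrow> ev (f i) (q i) \<noteq> 0" "\<And>i p. i < m \<Longrightarrow> p \<in> c (Suc i) \<Longrightarrow> ev (f i) p = 0"
  proof -
    have "\<forall>i\<in>{..<m}. \<exists>fq. snd fq \<in> c i \<and> fst fq \<in> Fr (r + n) \<and> ev (fst fq) (snd fq) \<noteq> 0 \<and>
      (\<forall>p\<in>c (Suc i). ev (fst fq) p = 0)"
      by (rule ballI, rule choose) simp
    from bchoice[OF this] obtain fq where fq: "\<forall>i\<in>{..<m}. snd (fq i) \<in> c i \<and> fst (fq i) \<in> Fr (r + n) \<and>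
        ev (fst (fq i)) (snd (fq i)) \<noteq> 0 \<and> (\<forall>p\<in>c (Suc i). ev (fst (fq i)) p = 0)"
      by (rule exE)
    show ?thesis by (rule that[of "\<lambda>i. snd (fq i)" "\<lambda>i. fst (fq i)"]) (use fq in auto)
  qed
  obtain p where p: "p \<in> c m" using c(3) by auto
  have pY: "p \<in> Y" using p cY by auto
  have qY: "q i \<in> Y" if "i < m" for i using fq(1)[OF that] cY[of i] that by auto
  define v where "v i = snd (\<pi> (f i))" for i
  \<comment> \<open>Subtracting the value at \<open>p\<close>, a point of the last and smallest
    member, removes the constant parts of the \<open>f l\<close>, since all of them vanish at
    \<open>p\<close>.\<close>
  define \<delta> where "\<delta> i x j = fox r (ev (lift x) (q i)) j - fox r (ev (lift x) p) j" for i x j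
  have fp: "ev (f i) p = 0" if "i < m" for i
    using fq(4)[OF that] anti[of "Suc i" m] p that by auto
  have vM: "v i \<in> carrier M" if "i < m" for i using fq(2)[OF that] by (simp add: v_def)
  have \<delta>: "\<delta> i (v l) j = fox r (ev (f l) (q i)) j" if "i < m" "l < m" for i l j
  proof -
    note f = fq(2)[OF that(2)]
    have "fox r (ev (f l) (q i)) j = fox r (fst (\<pi> (f l))) j + fox r (ev (lift (v l)) (q i)) j"
      unfolding v_def fox_simps(2)[symmetric] using ev_decomp[OF f qY[OF that(1)]] by (rule arg_cong)
    moreover have "fox r (ev (f l) p) j = fox r (fst (\<pi> (f l))) j + fox r (ev (lift (v l)) p) j"
      unfolding v_def fox_simps(2)[symmetric] using ev_decomp[OF f pY] by (rule arg_cong)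
    ultimately show ?thesis using fp[OF that(2)] by (simp add: \<delta>_def neg_eq_iff_add_eq_0 add.commute)
  qed
  \<comment> \<open>For \<open>l < i\<close> the point \<open>q i\<close> lies in
    \<open>c (Suc l)\<close>, where \<open>f l\<close> vanishes.\<close>
  have \<delta>less: "\<delta> i (v l) j = 0" if "l < i" "i < m" for i l j
  proof -
    have "q i \<in> c (Suc l)" using fq(1)[of i] anti[of "Suc l" i] that by auto
    then show ?thesis using fq(4)[of l] \<delta> that by simp
  qed
  have \<delta>diag: "\<exists>j. \<delta> i (v i) j \<noteq> 0" if "i < m" for i
    using fq(2,3)[OF that] qY[OF that] pY fp[OF that] \<delta>[OF that that] by (auto simp: ev_eq_zero_iff)
  have inj: "inj_on v {..<m}"
  proof (rule inj_onI, rule ccontr)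
    fix a b assume ab: "a \<in> {..<m}" "b \<in> {..<m}" "v a = v b" "a \<noteq> b"
    show False
    proof (cases "a < b")
      case True
      then show False using \<delta>diag[of b] \<delta>less[of a b] ab by simp
    next
      case False
      then show False using \<delta>diag[of a] \<delta>less[of b a] ab by simp
    qed
  qed
  have "lin_indep (Rring r) M (v ` {..<m})"
    unfolding lin_indep_def
  proof (intro conjI allI impI ballI)
    show "v ` {..<m} \<subseteq> carrier M" using vM by auto
    fix T d u
    assume T: "finite T" "T \<subseteq> v ` {..<m}" "d \<in> T \<rightarrow> carrier (Rring r)"
      "finsum M (\<lambda>v. d v \<odot>\<^bsub>M\<^esub> v) T = \<zero>\<^bsub>M\<^esub>" "u \<in> T"
    show "d u = \<zero>\<^bsub>Rring r\<^esub>"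
    proof (rule ccontr)
      assume "d u \<noteq> \<zero>\<^bsub>Rring r\<^esub>"
      \<comment> \<open>At the largest index with nonzero coefficient only one term survives:
        smaller indices drop out by triangularity, larger ones by maximality.\<close>
      define I where "I = {i. i < m \<and> v i \<in> T \<and> d (v i) \<noteq> 0}"
      have I: "finite I" "I \<noteq> {}"
        using \<open>d u \<noteq> _\<close> T(2,5) by (auto simp: I_def)
      define i where "i = Max I"
      have i: "i < m" "v i \<in> T" "d (v i) \<noteq> 0" "\<And>l. l \<in> I \<Longrightarrow> l \<le> i"
        using Max_in[OF I] I(1) unfolding i_def[symmetric] by (auto simp: I_def i_def)
      obtain j where j: "\<delta> i (v i) j \<noteq> 0" using \<delta>diag[OF i(1)] by blast
      have TM: "T \<subseteq> carrier M" using T(2) vM by auto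
      have "(\<Sum>x\<in>T. d x * \<delta> i x j) = 0"
        using fox_ev_lift_finsum[OF T(1) TM T(3) qY[OF i(1)], of j]
          fox_ev_lift_finsum[OF T(1) TM T(3) pY, of j] T(4) ev_lift_zero[OF pY] ev_lift_zero[OF qY[OF i(1)]]
        by (simp add: \<delta>_def right_diff_distrib sum_subtractf)
      moreover have "(\<Sum>x\<in>T. d x * \<delta> i x j) = d (v i) * \<delta> i (v i) j"
      proof (subst sum.remove[OF T(1) i(2)], simp, rule sum.neutral, rule ballI)
        fix x assume x: "x \<in> T - {v i}"
        then obtain l where l: "l < m" "x = v l" using T(2) by auto
        then consider "l < i" | "i < l" using x by (metis DiffE insertI1 linorder_neqE_nat)
        then show "d x * \<delta> i x j = 0"
        proof cases
          case 1 then show ?thesis using \<delta>less i(1) l by simp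
        next
          case 2
          then have "l \<notin> I" using i(4) by force
          then show ?thesis using l x by (auto simp: I_def)
        qed
      qed
      ultimately show False using j i(3) by simp
    qed
  qed
  moreover have "card (v ` {..<m}) = m" using card_image[OF inj] by simp
  ultimately show ?thesis by blast
qed

section \<open>Strict chains from independent elements, and the dimension\<close>

lemma domain_Rring: "domain (Rring r :: 'k kpoly ring)"
  by (rule domain.intro[OF module.axioms(1)[OF module_M]]) (simp add: domain_axioms_def)

text \<open>The elements of \<open>S\<close> are required to vanish one after another. Strictness
  comes from a functional that is zero on all of \<open>S\<close> except the next element.\<close>

lemma chain_of_independent:
  assumes "fin_gen (Rring r) M" "finite S" "lin_indep (Rring r) M S"
  shows "\<exists>c. c 0 = Y \<and> (\<forall>i\<le>card S. algebraic_set r n (c i) \<and> c i \<noteq> {} \<and> c i \<subseteq> Y) \<and>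
    (\<forall>i<card S. c (Suc i) \<subset> c i)"
proof -
  obtain s where s: "bij_betw s {0..<card S} S" using ex_bij_betw_nat_finite[OF assms(2)] by blast
  have sS: "s i \<in> S" if "i < card S" for i using s that by (auto simp: bij_betw_def)
  have sM: "s i \<in> carrier M" if "i < card S" for i
    using sS[OF that] assms(3) by (auto simp: lin_indep_def)
  define c where "c i = {p \<in> Y. \<forall>j<i. ev (lift (s j)) p = 0}" for i
  have alg: "algebraic_set r n (c i)" if "i \<le> card S" for i
  proof -
    obtain S0 where S0: "S0 \<subseteq> Fr (r + n)" "Y = Vset r n S0" using algebraic by (auto simp: algebraic_set_def)
    have "S0 \<union> (\<lambda>j. lift (s j)) ` {..<i} \<subseteq> Fr (r + n)" using S0(1) sM lift(1) that by auto
    moreover have "c i = Vset r n (S0 \<union> (\<lambda>j. lift (s j)) ` {..<i})"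
      unfolding c_def S0(2) by (auto simp: Vset_def)
    ultimately show ?thesis unfolding algebraic_set_def by blast
  qed
  \<comment> \<open>The zero homomorphism, a point common to all members of the chain.\<close>
  obtain p0 where p0: "p0 \<in> Y"
      "\<And>f j. f \<in> Fr (r + n) \<Longrightarrow> fox r (ev f p0) j = fox r (fst (\<pi> f)) j + 0"
    by (rule point_exists[of "\<lambda>_ _. 0"]) (auto intro: bexI[OF _ DF.zero])
  have ne: "p0 \<in> c i" if "i \<le> card S" for i
    unfolding c_def using p0 that sM lift by (simp add: ev_eq_zero_iff)
  have strict: "c (Suc i) \<subset> c i" if i: "i < card S" for i
  proof -
    obtain h where h: "h \<in> carrier M \<rightarrow> carrier (Rring r)"
      "\<forall>x\<in>carrier M. \<forall>y\<in>carrier M. h (x \<oplus>\<^bsub>M\<^esub> y) = h x + h y"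
      "\<forall>a\<in>carrier (Rring r). \<forall>x\<in>carrier M. h (a \<odot>\<^bsub>M\<^esub> x) = a * h x"
      "h (s i) \<noteq> 0" "\<forall>t\<in>S - {s i}. h t = 0"
      using M.separating_functional[OF domain_Rring assms(1,2,3) sS[OF i]] by auto
    \<comment> \<open>Multiplying by this commutator turns a functional with values in R into a
      homomorphism into the derived algebra. Its coordinate 0 is \<open>pvar 1\<close>, which is
      nonzero, so no information is lost.\<close>
    let ?w = "fbr (gen 0) (gen 1) :: 'k fml"
    obtain p where p: "p \<in> Y"
      "\<And>f j. f \<in> Fr (r + n) \<Longrightarrow> fox r (ev f p) j = fox r (fst (\<pi> f)) j + h (snd (\<pi> f)) * fox r ?w j"
    proof (rule point_exists[of "\<lambda>x j. h x * fox r ?w j"])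
      fix x assume "x \<in> carrier M"
      then show "\<exists>w\<in>DF r. \<forall>j. fox r w j = h x * fox r ?w j"
        using h(1) r2 by (intro DF_fox_scale) (auto intro: DF.comm)
    qed (use h in \<open>auto simp: algebra_simps\<close>)
    have fp: "fox r (ev (lift (s l)) p) j = h (s l) * fox r ?w j" if "l < card S" for l j
      using p(2)[of "lift (s l)" j] lift sM[OF that] by simp
    have "h (s l) = 0" if "l < i" for l
      using h(5) s i that sS[of l] unfolding bij_betw_def by (auto dest: inj_onD)
    then have "p \<in> c i"
      using i p(1) sM lift fp by (auto simp: c_def ev_eq_zero_iff)
    moreover have "fox r (ev (lift (s i)) p) 0 \<noteq> 0"
      using fp[OF i, of 0] h(4) r2 by simp
    then have "p \<notin> c (Suc i)" by (auto simp: c_def)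
    ultimately show ?thesis by (auto simp: c_def)
  qed
  have "c 0 = Y" "\<And>i. c i \<subseteq> Y" by (auto simp: c_def)
  then show ?thesis using alg ne strict by blast
qed

lemma zdim_eq_mrank:
  assumes "fin_gen (Rring r) M" "Y \<noteq> {}"
  shows "zdim r n Y = mrank (Rring r) M"
proof (rule antisym)
  show "zdim r n Y \<le> mrank (Rring r) M"
    unfolding zdim_def
  proof (rule SUP_least)
    fix m assume "m \<in> {m. \<exists>c. c 0 = Y \<and>
        (\<forall>i\<le>m. algebraic_set r n (c i) \<and> z_irreducible r n (c i)) \<and> (\<forall>i<m. c (Suc i) \<subset> c i)}"
    then obtain c where c: "c 0 = Y" "\<forall>i\<le>m. algebraic_set r n (c i) \<and> z_irreducible r n (c i)"
      "\<forall>i<m. c (Suc i) \<subset> c i" by blast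
    have "c m \<noteq> {}" using c(2) unfolding z_irreducible_def by blast
    then have "\<exists>S. lin_indep (Rring r) M S \<and> card S = m"
      using c by (intro independent_of_chain[of c]) simp_all
    then obtain S where "lin_indep (Rring r) M S" "m = card S" by blast
    then show "enat m \<le> mrank (Rring r) M"
      using SUP_upper[of S "{S. lin_indep (Rring r) M S}" "\<lambda>S. enat (card S)"]
      unfolding mrank_def by simp
  qed
  show "mrank (Rring r) M \<le> zdim r n Y"
    unfolding mrank_def
  proof (rule SUP_least)
    fix S assume "S \<in> {S. lin_indep (Rring r) M S}"
    then have S: "lin_indep (Rring r) M S" by simp
    have "\<exists>c. c 0 = Y \<and> (\<forall>i\<le>card S. algebraic_set r n (c i) \<and> c i \<noteq> {} \<and> c i \<subseteq> Y) \<and>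
      (\<forall>i<card S. c (Suc i) \<subset> c i)"
    proof (cases "finite S")
      case True then show ?thesis using chain_of_independent assms S by blast
    next
      \<comment> \<open>An infinite \<open>S\<close> has \<open>card S = 0\<close>, so the chain
        consisting of \<open>Y\<close> alone suffices; infinite independent sets thus add nothing to
        the supremum.\<close>
      case False then show ?thesis using algebraic assms(2) by (auto intro!: exI[of _ "\<lambda>_. Y"])
    qed
    then obtain c where c: "c 0 = Y" "\<forall>i\<le>card S. algebraic_set r n (c i) \<and> c i \<noteq> {} \<and> c i \<subseteq> Y"
      "\<forall>i<card S. c (Suc i) \<subset> c i" by blast
    have "\<forall>i\<le>card S. algebraic_set r n (c i) \<and> z_irreducible r n (c i)"
      using c(2) irreducible by simp
    then have "card S \<in> {m. \<exists>c. c 0 = Y \<and>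
        (\<forall>i\<le>m. algebraic_set r n (c i) \<and> z_irreducible r n (c i)) \<and> (\<forall>i<m. c (Suc i) \<subset> c i)}"
      using c(1,3) by (intro CollectI exI[of _ c] conjI)
    then show "enat (card S) \<le> zdim r n Y" unfolding zdim_def by (rule SUP_upper)
  qed
qed

end

theorem theorem5p2:
  fixes r n :: nat
    and Y :: "('k::{field,finite}) fml list set"
    and M :: "('k kpoly, 'm) module"
  assumes "r \<ge> 2"
    and "algebraic_set r n Y"
    and "z_irreducible r n Y"
    and "module (Rring r) M"
    and "fin_gen (Rring r) M"
    and "torsion_free (Rring r) M"
    and "coord_iso_Fr r n Y M"
  shows "zdim r n Y = mrank (Rring r) M"
proof -
  from assms(7) obtain \<psi> where \<psi>: "coord_algebra r n Y M \<psi>"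
    unfolding coord_iso_Fr_def
  proof (elim exE conjE)
    fix \<psi>
    assume "bij_betw \<psi> (Gamma r n Y) (Fr r \<times> carrier M)"
      "\<forall>f\<in>Fr (r + n). \<forall>g\<in>Fr (r + n).
        \<psi> (coset r n Y (fadd f g)) = sd_add M (\<psi> (coset r n Y f)) (\<psi> (coset r n Y g)) \<and>
        \<psi> (coset r n Y (fbr f g)) = sd_br r M (\<psi> (coset r n Y f)) (\<psi> (coset r n Y g))"
      "\<forall>c. \<forall>f\<in>Fr (r + n). \<psi> (coset r n Y (fsmult c f)) = sd_smult M c (\<psi> (coset r n Y f))"
      "\<forall>u\<in>Fr r. \<psi> (coset r n Y u) = (u, \<zero>\<^bsub>M\<^esub>)"
    then have "coord_algebra r n Y M \<psi>"
      by (intro coord_algebra.intro assms(1,2,4)) blast+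
    then show thesis by (rule that)
  qed
  have "Y \<noteq> {}" using assms(3) unfolding z_irreducible_def by (rule conjunct1)
  then show ?thesis by (rule coord_algebra.zdim_eq_mrank[OF \<psi> assms(5)])
qed

end
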